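(* Let $m\geq 3$ and $h\geq 0$ be integers. For a fixed integer $t\geq 1$, let $r=\left(\sum_{i=0}^{t-1}m^i\right)+s=\frac{m^t-1}{m-1}+s$ for some $s\in\{0,1,\dots,m^t-1\}$. Then $$\mathrm{Ind}_r(B_h^m)\simeq\begin{cases}\displaystyle\bigvee_{p_1}\mathbb{S}^{q_1}, & \text{if } h=(k-1)(t+2)+t+1 \text{ for some integer } k\geq 1,\\ \displaystyle\bigvee_{p_2}\mathbb{S}^{q_2}, & \text{if } h=k(t+2)+t \text{ for some integer } k\geq 0,\\ \{\mathrm{point}\}, & \text{otherwise,}\end{cases}$$ where $$p_1=\binom{m^t-1}{s}^{m\left(m^0+m^{t+2}+\dots+m^{(k-1)(t+2)}\right)},\qquad q_1=mr\left(m^0+m^{t+2}+\dots+m^{(k-1)(t+2)}\right)-1,$$ $$p_2=\binom{m^t-1}{s}^{m^0+m^{t+2}+\dots+m^{k(t+2)}},\qquad q_2=r\left(m^0+m^{t+2}+\dots+m^{k(t+2)}\right)-1.$$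
   Context: $B_h^m$ denotes the perfect $m$-ary tree of height $h$: the rooted tree in which every node of depth less than $h$ has exactly $m$ children and every node of depth $h$ is a leaf node (no children); the depth of a node is the number of edges from it to the root. It has $\sum_{i=0}^h m^i$ nodes. It is regarded as an undirected graph. For a graph $G$ and an integer $r\geq 1$, a subset $I\subseteq V(G)$ is $r$-independent if every connected component of the induced subgraph $G[I]$ has at most $r$ vertices; the $r$-independence complex $\mathrm{Ind}_r(G)$ is the simplicial complex on vertex set $V(G)$ whose simplices are all $r$-independent subsets of $V(G)$ (identified with its geometric realization). Here $\simeq$ denotes homotopy equivalence and $\bigvee_{p}\mathbb{S}^q$ denotes a wedge of $p$ copies of the $q$-sphere. *)

theory Defs
  imports "HOL-Analysis.Analysis" "Graph_Theory.Graph_Theory"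
begin

section \<open>Perfect trees\<close>

text \<open>
  A node is the list of choices leading to it, most recent choice first. Thus \<open>[]\<close> is the root,
  the length of a list is its depth, and the children of \<open>u\<close> are the lists \<open>i # u\<close> with \<open>i < m\<close>.
  As usual in \<open>Graph_Theory\<close>, an undirected edge is a pair of opposite arcs.
\<close>

definition perfect_tree :: "nat \<Rightarrow> nat \<Rightarrow> nat list pair_pre_digraph" where
  "perfect_tree m h =
    (let V = {u. set u \<subseteq> {..<m} \<and> length u \<le> h}
     in \<lparr> pverts = V,
          parcs = {(u, v). u \<in> V \<and> v \<in> V \<and> (\<exists>i. v = i # u \<or> u = i # v)} \<rparr>)"

lemma pverts_perfect_tree:
  "pverts (perfect_tree m h) = {u. set u \<subseteq> {..<m} \<and> length u \<le> h}"
  by (simp add: perfect_tree_def Let_def)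

lemma card_perfect_tree: "card (pverts (perfect_tree m h)) = (\<Sum>i\<le>h. m ^ i)"
  unfolding pverts_perfect_tree using card_lists_length_le[of "{..<m}" h] by simp

lemma pair_graph_perfect_tree: "pair_graph (perfect_tree m h)"
proof
  show fin: "finite (pverts (perfect_tree m h))"
    unfolding pverts_perfect_tree using finite_lists_length_le[of "{..<m}" h] by simp
  have "parcs (perfect_tree m h) \<subseteq> pverts (perfect_tree m h) \<times> pverts (perfect_tree m h)"
    by (auto simp: perfect_tree_def Let_def)
  then show "finite (parcs (perfect_tree m h))"
    using fin by (meson finite_SigmaI finite_subset)
  show "symmetric (with_proj (perfect_tree m h))"
    by (auto simp: symmetric_def sym_def perfect_tree_def Let_def)
qed (auto simp: perfect_tree_def Let_def)

section \<open>Independence complexes\<close>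

text \<open>
  In a symmetric digraph the connected components are the strongly connected ones;
  \<open>sccs_verts\<close> is the family of their vertex sets.
\<close>

definition r_independent :: "nat \<Rightarrow> ('a, 'b) pre_digraph \<Rightarrow> 'a set \<Rightarrow> bool" where
  "r_independent r G I \<longleftrightarrow>
     I \<subseteq> verts G \<and>
     (\<forall>C \<in> pre_digraph.sccs_verts (G \<restriction> I). finite C \<and> card C \<le> r)"

definition independence_complex :: "nat \<Rightarrow> ('a, 'b) pre_digraph \<Rightarrow> 'a set set" where
  "independence_complex r G = {I. finite I \<and> r_independent r G I}"

text \<open>
  Points are given by barycentric coordinates. The empty simplex contributes no point. The topology
  is that of pointwise convergence, which is the usual one when \<open>K\<close> is finite, the only case
  considered here.
\<close>

definition geometric_realization :: "'v set set \<Rightarrow> ('v \<Rightarrow> real) topology" where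
  "geometric_realization K =
     subtopology (powertop_real UNIV)
       {x. (\<forall>v. 0 \<le> x v) \<and> {v. x v \<noteq> 0} \<in> K \<and> (\<Sum>v | x v \<noteq> 0. x v) = 1}"

section \<open>Wedge sums\<close>

text \<open>
  The wedge sum of the spaces \<open>X i\<close> with base points \<open>b i\<close>: \<open>None\<close> is the common base point,
  \<open>Some (i, x)\<close> is the point \<open>x \<noteq> b i\<close> of the \<open>i\<close>-th summand. The topology is the final one for
  the inclusions of the summands, i.e. the quotient topology of the disjoint sum
  (see \<open>quotient_map_wedge\<close>); the empty wedge is a point.
\<close>

definition wedge_incl :: "('i \<Rightarrow> 'a) \<Rightarrow> 'i \<Rightarrow> 'a \<Rightarrow> ('i \<times> 'a) option" where
  "wedge_incl b i x = (if x = b i then None else Some (i, x))"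

definition wedge :: "'i set \<Rightarrow> ('i \<Rightarrow> 'a topology) \<Rightarrow> ('i \<Rightarrow> 'a) \<Rightarrow> ('i \<times> 'a) option topology" where
  "wedge J X b = topology (\<lambda>U.
     U \<subseteq> insert None (\<Union>i\<in>J. wedge_incl b i ` topspace (X i)) \<and>
     (\<forall>i\<in>J. openin (X i) {x \<in> topspace (X i). wedge_incl b i x \<in> U}))"

lemma openin_wedge:
  "openin (wedge J X b) U \<longleftrightarrow>
     U \<subseteq> insert None (\<Union>i\<in>J. wedge_incl b i ` topspace (X i)) \<and>
     (\<forall>i\<in>J. openin (X i) {x \<in> topspace (X i). wedge_incl b i x \<in> U})"
proof -
  have 1: "{x \<in> topspace (X i). wedge_incl b i x \<in> S \<inter> T} =
      {x \<in> topspace (X i). wedge_incl b i x \<in> S} \<inter> {x \<in> topspace (X i). wedge_incl b i x \<in> T}"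
    for i S T
    by auto
  have 2: "{x \<in> topspace (X i). wedge_incl b i x \<in> \<Union>\<K>} =
      (\<Union>K\<in>\<K>. {x \<in> topspace (X i). wedge_incl b i x \<in> K})" for i \<K>
    by auto
  have "istopology (\<lambda>U. U \<subseteq> insert None (\<Union>i\<in>J. wedge_incl b i ` topspace (X i)) \<and>
     (\<forall>i\<in>J. openin (X i) {x \<in> topspace (X i). wedge_incl b i x \<in> U}))"
    unfolding istopology_def 1 2 by blast
  then show ?thesis
    by (simp add: wedge_def topology_inverse')
qed

lemma topspace_wedge:
  "topspace (wedge J X b) = insert None (\<Union>i\<in>J. wedge_incl b i ` topspace (X i))"
  (is "_ = ?T")
proof
  show "topspace (wedge J X b) \<subseteq> ?T"
    using openin_topspace[of "wedge J X b"] unfolding openin_wedge by simp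
  have "{x \<in> topspace (X i). wedge_incl b i x \<in> ?T} = topspace (X i)" if "i \<in> J" for i
    using that by auto
  then have "openin (wedge J X b) ?T"
    unfolding openin_wedge by simp
  then show "?T \<subseteq> topspace (wedge J X b)"
    by (rule openin_subset)
qed

lemma quotient_map_wedge:
  assumes "J \<noteq> {}" and "\<And>i. i \<in> J \<Longrightarrow> b i \<in> topspace (X i)"
  shows "quotient_map (sum_topology X J) (wedge J X b) (\<lambda>(i, x). wedge_incl b i x)"
proof -
  let ?q = "\<lambda>(i, x). wedge_incl b i x"
  have "None \<in> ?q ` Sigma J (topspace \<circ> X)"
    using assms by (fastforce simp: wedge_incl_def image_iff)
  then have im: "?q ` Sigma J (topspace \<circ> X) = topspace (wedge J X b)"
    unfolding topspace_wedge by force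
  have "openin (sum_topology X J) {z \<in> Sigma J (topspace \<circ> X). ?q z \<in> U} \<longleftrightarrow>
      openin (wedge J X b) U" if "U \<subseteq> topspace (wedge J X b)" for U
  proof -
    have "{x. (i, x) \<in> {z \<in> Sigma J (topspace \<circ> X). ?q z \<in> U}} =
        {x \<in> topspace (X i). wedge_incl b i x \<in> U}" if "i \<in> J" for i
      using that by auto
    then show ?thesis
      using that unfolding openin_sum_topology openin_wedge topspace_wedge by auto
  qed
  then show ?thesis
    unfolding quotient_map_def using im by simp
qed

definition wedge_of_spheres :: "nat \<Rightarrow> nat \<Rightarrow> (nat \<times> (nat \<Rightarrow> real)) option topology" where
  "wedge_of_spheres p q = wedge {..<p} (\<lambda>_. nsphere q) (\<lambda>_ n. if n = 0 then 1 else 0)"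

end

theory Submission
  imports Defs
begin

text \<open>
  The proof is discrete Morse theory for a matching all of whose critical simplices are facets.
  Only two facts about a finite complex are then needed from topology. If the complex can be emptied
  by elementary collapses, its realization is contractible (\<open>erasable_imp_contractible\<close>). If removing
  a set of facets, each with \<open>q + 1\<close> vertices, leaves a contractible nonempty complex, the realization
  is a wedge of \<open>q\<close>-spheres, one for each facet (\<open>attach_facets_wedge\<close>): contracting the rest turns
  each facet into a simplex with its boundary collapsed to a point.

  For the combinatorics, give a node of depth \<open>d\<close> the level \<open>(h - d) mod (t + 2)\<close>. The nodes of level
  \<open>t + 1\<close> separate the tree into blocks, whose nodes have the levels from \<open>t\<close> at the root of the block
  down to \<open>0\<close> at its leaves. Every block is a perfect tree of height \<open>t\<close>, except that the topmost one has
  height \<open>h mod (t + 2)\<close> if this is less than \<open>t\<close>. Let \<open>n\<close> be the number \<open>1 + m + \<dots> + m ^ (t - 1)\<close> of inner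
  nodes, i.e. those of levels \<open>1\<close> to \<open>t\<close>, of a full block; thus \<open>n \<le> r = n + s < n + m ^ t\<close>.

  Group the independent sets \<open>I\<close> by their trace \<open>E\<close> on the separators and the inner nodes.
  If \<open>E\<close> contains a separator, let \<open>y\<close> be a deepest one. The inner nodes just below \<open>y\<close> cannot all lie in
  \<open>E\<close>, as together with \<open>y\<close> they would form a connected set of \<open>n + m ^ t > r\<close> nodes. So some inner node
  \<open>w\<close> below \<open>y\<close> is missing, and a leaf of the block below \<open>w\<close> can be added to \<open>I\<close> or removed from it freely:
  its component stays in a tree of height less than \<open>t\<close>, which has at most \<open>n \<le> r\<close> nodes. The same leaf
  works if \<open>E\<close> contains no separator but misses an inner node \<open>w\<close>, and a leaf of the topmost block works if
  \<open>E\<close> contains no separator and that block has height less than \<open>t\<close>. In all these cases the sets of trace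
  \<open>E\<close> form a cone and are matched completely. This settles the case \<open>h mod (t + 2) < t\<close>, where the complex
  is a point up to homotopy.

  Otherwise all blocks are full, and the only trace left consists of all inner nodes and no separator.
  The inner nodes of a block are connected, so independence now means that at most \<open>s\<close> leaves are
  chosen in each block. Fix one leaf in every block. Adding and removing the fixed leaf of a suitable
  block matches all these sets, except those that contain exactly \<open>s\<close> leaves of each block and none of
  the fixed ones. The latter are facets with \<open>n + s = r\<close> nodes in each block, and there are
  \<open>(m ^ t - 1) choose s\<close> choices for each block. Counting the blocks by the depth of their roots gives the
  sums of powers of \<open>m\<close>.
\<close>

section \<open>Realizations and elementary collapses\<close>

text \<open>
  The underlying set of \<^const>\<open>geometric_realization\<close>. The product topology on functions is the
  topology of the type class, so that the realization is a plain subspace and continuity can be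
  handled with \<^const>\<open>continuous_on\<close>.
\<close>

definition realization :: "'v set set \<Rightarrow> ('v \<Rightarrow> real) set" where
  "realization K = {x. (\<forall>v. 0 \<le> x v) \<and> {v. x v \<noteq> 0} \<in> K \<and> (\<Sum>v | x v \<noteq> 0. x v) = 1}"

lemma geometric_realization_eq: "geometric_realization K = top_of_set (realization K)"
  by (simp add: geometric_realization_def realization_def euclidean_product_topology)

text \<open>
  The empty simplex is a member of every nonempty complex; this is why the matchings below
  may pair a vertex with it.
\<close>

definition finite_complex :: "'v set set \<Rightarrow> bool" where
  "finite_complex K \<longleftrightarrow> finite K \<and> (\<forall>\<sigma>\<in>K. finite \<sigma> \<and> (\<forall>\<tau>\<subseteq>\<sigma>. \<tau> \<in> K))"

lemma finite_complex_finite: "finite_complex K \<Longrightarrow> finite K"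
  by (simp add: finite_complex_def)

lemma finite_complex_face_finite: "finite_complex K \<Longrightarrow> \<sigma> \<in> K \<Longrightarrow> finite \<sigma>"
  by (simp add: finite_complex_def)

lemma finite_complex_down: "finite_complex K \<Longrightarrow> \<sigma> \<in> K \<Longrightarrow> \<tau> \<subseteq> \<sigma> \<Longrightarrow> \<tau> \<in> K"
  by (auto simp: finite_complex_def)

lemma finite_complex_diff:
  assumes "finite_complex K" "\<And>\<sigma> \<tau>. \<sigma> \<in> C \<Longrightarrow> \<tau> \<in> K \<Longrightarrow> \<sigma> \<subseteq> \<tau> \<Longrightarrow> \<tau> \<in> C"
  shows "finite_complex (K - C)"
  using assms unfolding finite_complex_def by (metis Diff_iff finite_Diff)

lemma realization_iff:
  assumes "finite A" "{v. x v \<noteq> 0} \<subseteq> A"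
  shows "x \<in> realization K \<longleftrightarrow> (\<forall>v. 0 \<le> x v) \<and> {v. x v \<noteq> 0} \<in> K \<and> sum x A = 1"
proof -
  have "sum x {v. x v \<noteq> 0} = sum x A"
    by (rule sum.mono_neutral_left) (use assms in auto)
  then show ?thesis by (simp add: realization_def)
qed

lemma realization_subset: "L \<subseteq> K \<Longrightarrow> realization L \<subseteq> realization K"
  by (auto simp: realization_def)

lemma realization_nonneg: "x \<in> realization K \<Longrightarrow> 0 \<le> x v"
  by (auto simp: realization_def)

lemma realization_support: "x \<in> realization K \<Longrightarrow> {v. x v \<noteq> 0} \<in> K"
  by (auto simp: realization_def)

lemma continuous_on_coordinate [continuous_intros]: "continuous_on S (\<lambda>x::'v \<Rightarrow> real. x i)"
  by (rule continuous_on_subset[OF continuous_on_product_coordinates]) simp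

lemma continuous_on_snd_coordinate [continuous_intros]:
  "continuous_on S (\<lambda>p::'a::topological_space \<times> ('v \<Rightarrow> real). snd p i)"
  by (rule continuous_on_product_then_coordinatewise) (rule continuous_on_snd[OF continuous_on_id])

lemma continuous_on_Min_image [continuous_intros]:
  fixes f :: "'a::topological_space \<Rightarrow> 'v \<Rightarrow> real"
  assumes "finite A" "A \<noteq> {}" "continuous_on S f"
  shows "continuous_on S (\<lambda>x. Min (f x ` A))"
  using assms(1,2)
proof (induction rule: finite_ne_induct)
  case (singleton w)
  then show ?case using continuous_on_product_then_coordinatewise[OF assms(3)] by simp
next
  case (insert w A)
  have "continuous_on S (\<lambda>x. min (f x w) (Min (f x ` A)))"
    by (intro continuous_on_min continuous_on_product_then_coordinatewise[OF assms(3)] insert)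
  then show ?case using insert by simp
qed

text \<open>
  The congruence assumption on \<open>P\<close> allows the two ends of the homotopy to be prescribed on \<open>S\<close> only.
\<close>

lemma homotopic_with_top_of_setI:
  fixes h :: "real \<Rightarrow> 'a::topological_space \<Rightarrow> 'b::topological_space"
  assumes "continuous_on ({0..1} \<times> S) (\<lambda>(u, x). h u x)"
    and "\<And>u x. 0 \<le> u \<Longrightarrow> u \<le> 1 \<Longrightarrow> x \<in> S \<Longrightarrow> h u x \<in> T"
    and "\<And>x. x \<in> S \<Longrightarrow> h 0 x = f x" and "\<And>x. x \<in> S \<Longrightarrow> h 1 x = g x"
    and "\<And>u. 0 \<le> u \<Longrightarrow> u \<le> 1 \<Longrightarrow> P (h u)"
    and "\<And>h k. (\<And>x. x \<in> S \<Longrightarrow> h x = k x) \<Longrightarrow> P h = P k"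
  shows "homotopic_with P (top_of_set S) (top_of_set T) f g"
proof -
  have "continuous_map (prod_topology (top_of_set {0..1}) (top_of_set S)) (top_of_set T) (\<lambda>(u, x). h u x)"
    using assms(1,2) by (auto simp: Pi_iff)
  moreover have "\<forall>x\<in>S. h 0 x = f x" "\<forall>x\<in>S. h 1 x = g x" "\<forall>u\<in>{0..1}. P (h u)"
    using assms(3-5) by auto
  ultimately have ex: "\<exists>h. continuous_map (prod_topology (top_of_set {0..1::real}) (top_of_set S)) (top_of_set T) h \<and>
      (\<forall>x\<in>topspace (top_of_set S). h (0, x) = f x) \<and> (\<forall>x\<in>topspace (top_of_set S). h (1, x) = g x) \<and>
      (\<forall>u\<in>{0..1}. P (\<lambda>x. h (u, x)))"
    by - (intro exI[of _ "\<lambda>(u, x). h u x"] conjI, simp_all)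
  have P_cong: "P p = P q" if "\<And>x. x \<in> topspace (top_of_set S) \<Longrightarrow> p x = q x" for p q
    by (rule assms(6)) (use that in simp)
  show ?thesis
    using iffD2[OF homotopic_with[OF P_cong] ex] .
qed

text \<open>
  The only simplices that contain \<open>\<sigma>\<close> are \<open>\<sigma>\<close> and \<open>insert v \<sigma>\<close>. Let \<open>a x\<close> be the least coordinate of \<open>x\<close>
  on \<open>\<sigma>\<close>, which vanishes unless the support of \<open>x\<close> contains \<open>\<sigma>\<close>. Moving the mass \<open>a x\<close> from each vertex
  of \<open>\<sigma>\<close> to \<open>v\<close> is therefore a deformation, given by one formula on the whole realization, that
  retracts it to the realization of the remaining complex.
\<close>

lemma elementary_collapse_contractible:
  assumes K: "finite_complex K" and L: "finite_complex L" "L = K - {\<sigma>, insert v \<sigma>}"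
    and \<sigma>: "\<sigma> \<noteq> {}" "v \<notin> \<sigma>" "insert v \<sigma> \<in> K"
    and contr: "contractible (realization L)"
  shows "contractible (realization K)"
proof -
  define a where "a x = Min (x ` \<sigma>)" for x :: "'a \<Rightarrow> real"
  define h where "h u x = (\<lambda>w. if w \<in> \<sigma> then x w - u * a x
      else if w = v then x w + u * (real (card \<sigma>) * a x) else x w)" for u x
  have fin\<sigma>: "finite \<sigma>" using K \<sigma> by (auto simp: finite_complex_def)
  have star: "\<tau> = \<sigma> \<or> \<tau> = insert v \<sigma>" if "\<tau> \<in> K" "\<sigma> \<subseteq> \<tau>" for \<tau>
    using L \<sigma> that unfolding finite_complex_def by blast
  have a_le: "a x \<le> x w" if "w \<in> \<sigma>" for x w
    unfolding a_def using fin\<sigma> that by simp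
  have a_nonneg: "0 \<le> a x" if "x \<in> realization K" for x
    unfolding a_def using fin\<sigma> \<sigma> realization_nonneg[OF that] by simp
  have a_zero: "a x = 0" if "x \<in> realization K" "\<not> \<sigma> \<subseteq> {v. x v \<noteq> 0}" for x
  proof -
    obtain w where "w \<in> \<sigma>" "x w = 0" using \<open>\<not> \<sigma> \<subseteq> _\<close> by auto
    with a_le[of w x] a_nonneg[OF that(1)] show ?thesis by simp
  qed
  have h_triv: "h u x = x" if "a x = 0" for u x
    using that by (auto simp: h_def)
  have h_cont: "continuous_on S (\<lambda>(u, x). h u x)" for S
    unfolding h_def a_def case_prod_beta
  proof (rule continuous_on_coordinatewise_then_product, goal_cases)
    case (1 i)
    show ?case
      by (cases "i \<in> \<sigma>"; cases "i = v") (auto intro!: continuous_intros fin\<sigma> \<sigma>)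
  qed
  have h_in: "h u x \<in> realization K" and h1_in: "h 1 x \<in> realization L"
    if u: "0 \<le> u" "u \<le> 1" and x: "x \<in> realization K" for u x
  proof -
    have "h u x \<in> realization K \<and> h 1 x \<in> realization L"
    proof (cases "\<sigma> \<subseteq> {v. x v \<noteq> 0}")
      case False
      then have "{v. x v \<noteq> 0} \<in> L" using L realization_support[OF x] by auto
      then have "x \<in> realization L" using x by (auto simp: realization_def)
      then show ?thesis using x False by (simp add: a_zero h_triv)
    next
      case True
      have supp: "{v. x v \<noteq> 0} \<subseteq> insert v \<sigma>"
        using star[OF realization_support[OF x] True] by auto
      have pos: "0 \<le> h u x w" if "0 \<le> u" "u \<le> 1" for u w
      proof -
        have "u * a x \<le> a x" using that a_nonneg[OF x] by (simp add: mult_left_le_one_le)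
        then show ?thesis
          using a_le[of w x] a_nonneg[OF x] realization_nonneg[OF x] that by (auto simp: h_def)
      qed
      have supp': "{w. h u x w \<noteq> 0} \<subseteq> insert v \<sigma>" for u
        using supp by (auto simp: h_def)
      have "sum (h u x) (insert v \<sigma>) = h u x v + sum (h u x) \<sigma>" for u
        using fin\<sigma> \<sigma> by simp
      also have "\<dots> u = x v + u * (real (card \<sigma>) * a x) + (\<Sum>w\<in>\<sigma>. x w - u * a x)" for u
        using \<sigma> by (auto simp: h_def)
      also have "\<dots> u = x v + sum x \<sigma>" for u
        by (simp add: sum_subtractf)
      also have "\<dots> = 1"
        using realization_iff[of "insert v \<sigma>" x K] supp x fin\<sigma> \<sigma> by auto
      finally have sum1: "sum (h u x) (insert v \<sigma>) = 1" for u .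
      have inK: "{w. h u x w \<noteq> 0} \<in> K" for u
        using supp' finite_complex_down[OF K \<sigma>(3)] by blast
      obtain w where w: "w \<in> \<sigma>" "x w = a x"
        using Min_in[of "x ` \<sigma>"] fin\<sigma> \<sigma> unfolding a_def by fastforce
      then have "h 1 x w = 0" by (simp add: h_def)
      then have "{w. h 1 x w \<noteq> 0} \<in> L" using w inK[of 1] L by auto
      then show ?thesis
        using realization_iff[of "insert v \<sigma>" "h u x" K] realization_iff[of "insert v \<sigma>" "h 1 x" L]
          supp' sum1 pos u inK fin\<sigma> by auto
    qed
    then show "h u x \<in> realization K" "h 1 x \<in> realization L" by auto
  qed
  have "realization L \<subseteq> realization K" using L by (auto intro!: realization_subset)
  have hom: "homotopic_with (\<lambda>_. True) (top_of_set (realization K)) (top_of_set (realization K)) id (h 1)"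
    by (rule homotopic_with_top_of_setI[where h = h])
      (use h_cont h_in in \<open>auto simp: h_def\<close>)
  obtain c where c: "homotopic_with (\<lambda>_. True) (top_of_set (realization L)) (top_of_set (realization L)) id (\<lambda>_. c)"
    using contr by (auto simp: contractible_def)
  have h1: "continuous_map (top_of_set (realization K)) (top_of_set (realization L)) (h 1)"
    using continuous_on_o_Pair[OF h_cont, of 1 "{0..1}"] h1_in[of 0] by (simp add: comp_def image_subset_iff Pi_iff)
  have "homotopic_with (\<lambda>_. True) (top_of_set (realization K)) (top_of_set (realization K)) (id \<circ> (id \<circ> h 1)) (id \<circ> ((\<lambda>_. c) \<circ> h 1))"
    by (rule homotopic_with_compose_continuous_map_left[OF
          homotopic_with_compose_continuous_map_right[OF c h1]])
      (use \<open>realization L \<subseteq> _\<close> in \<open>auto simp: continuous_map_in_subtopology\<close>)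
  then have "homotopic_with (\<lambda>_. True) (top_of_set (realization K)) (top_of_set (realization K)) (h 1) (\<lambda>_. c)"
    by (simp add: comp_def)
  with hom show ?thesis
    unfolding contractible_def using homotopic_with_trans by blast
qed

section \<open>Complexes that collapse completely\<close>

text \<open>
  A family of finite sets is erasable if it splits into pairs \<open>\<sigma>\<close>, \<open>insert v \<sigma>\<close> that can be removed one
  after the other, each pair being free when its turn comes: in the union, \<open>B\<close> goes first since no
  member of \<open>A\<close> contains a member of \<open>B\<close>. In other words, the family has a complete acyclic matching.
  It need not be closed under subsets.
\<close>

inductive erasable :: "'v set set \<Rightarrow> bool" where
  empty: "erasable {}"
| pair: "v \<notin> \<sigma> \<Longrightarrow> erasable {\<sigma>, insert v \<sigma>}"
| union: "erasable A \<Longrightarrow> erasable B \<Longrightarrow> (\<And>a b. a \<in> A \<Longrightarrow> b \<in> B \<Longrightarrow> \<not> b \<subseteq> a) \<Longrightarrow> erasable (A \<union> B)"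

text \<open>
  A largest member without \<open>v\<close> lies, within the family, only below itself and its partner, so that
  this pair can go first.
\<close>

lemma erasable_cone:
  assumes "finite F" "\<And>\<sigma>. \<sigma> \<in> F \<Longrightarrow> finite \<sigma>"
    and "\<And>\<sigma>. \<sigma> \<in> F \<Longrightarrow> insert v \<sigma> \<in> F \<and> \<sigma> - {v} \<in> F"
  shows "erasable F"
  using assms
proof (induction "card F" arbitrary: F rule: less_induct)
  case less
  show ?case
  proof (cases "F = {}")
    case False
    define M where "M = {\<sigma> \<in> F. v \<notin> \<sigma>}"
    have "M \<noteq> {}" "finite M" using False less.prems unfolding M_def by auto
    then have "Max (card ` M) \<in> card ` M" by (intro Max_in) auto
    then obtain \<sigma> where \<sigma>: "\<sigma> \<in> M" "card \<sigma> = Max (card ` M)" by auto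
    have maximal: "card \<tau> \<le> card \<sigma>" if "\<tau> \<in> M" for \<tau>
      unfolding \<sigma>(2) using that \<open>finite M\<close> by simp
    define B where "B = {\<sigma>, insert v \<sigma>}"
    have star: "a \<in> B" if "a \<in> F" "\<sigma> \<subseteq> a" for a
    proof -
      have "a - {v} \<in> M" "finite (a - {v})" "\<sigma> \<subseteq> a - {v}"
        using that less.prems \<sigma> unfolding M_def by auto
      then have "\<sigma> = a - {v}" using maximal card_seteq by blast
      then show ?thesis unfolding B_def by auto
    qed
    have "B \<subseteq> F" using \<sigma> less.prems(3) unfolding B_def M_def by auto
    have "card (F - B) < card F"
      using less.prems(1) \<sigma>(1) by (intro psubset_card_mono) (auto simp: B_def M_def)
    moreover have "insert v \<tau> \<in> F - B \<and> \<tau> - {v} \<in> F - B" if "\<tau> \<in> F - B" for \<tau>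
    proof -
      have "\<not> \<sigma> \<subseteq> \<tau>" using that star by blast
      moreover have "\<sigma> \<subseteq> b" "v \<notin> \<sigma>" if "b \<in> B" for b using that \<sigma>(1) unfolding B_def M_def by auto
      ultimately have "insert v \<tau> \<notin> B" "\<tau> - {v} \<notin> B" by blast+
      then show ?thesis using that less.prems(3) by blast
    qed
    ultimately have "erasable (F - B)"
      using less.prems by (intro less.hyps) auto
    moreover have "erasable B"
      using \<sigma>(1) unfolding B_def M_def by (auto intro: erasable.pair)
    moreover have "\<not> b \<subseteq> a" if "a \<in> F - B" "b \<in> B" for a b
      using that star[of a] unfolding B_def by auto
    ultimately have "erasable (F - B \<union> B)" by (rule erasable.union)
    then show ?thesis using \<open>B \<subseteq> F\<close> by (simp add: Un_absorb2)
  qed (simp add: erasable.empty)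
qed

text \<open>
  Deciding the elements of \<open>D\<close> one at a time splits the family into the sets with \<open>d\<close>, which go first,
  and those without \<open>d\<close>. This is the patchwork theorem for the map \<open>\<sigma> \<mapsto> \<sigma> \<inter> D\<close>.
\<close>

lemma erasable_fibres:
  assumes "finite D" "\<And>E. E \<subseteq> D \<Longrightarrow> erasable {\<sigma> \<in> F. \<sigma> \<inter> D = E}"
  shows "erasable F"
  using assms
proof (induction D arbitrary: F rule: finite_induct)
  case empty
  then show ?case by simp
next
  case (insert d D)
  have "erasable {\<sigma> \<in> F. d \<notin> \<sigma>}"
  proof (rule insert.IH)
    fix E assume "E \<subseteq> D"
    then have "{\<sigma> \<in> {\<sigma> \<in> F. d \<notin> \<sigma>}. \<sigma> \<inter> D = E} = {\<sigma> \<in> F. \<sigma> \<inter> insert d D = E}"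
      using insert.hyps by auto
    then show "erasable {\<sigma> \<in> {\<sigma> \<in> F. d \<notin> \<sigma>}. \<sigma> \<inter> D = E}"
      using insert.prems[of E] \<open>E \<subseteq> D\<close> by (simp add: subset_insertI2)
  qed
  moreover have "erasable {\<sigma> \<in> F. d \<in> \<sigma>}"
  proof (rule insert.IH)
    fix E assume "E \<subseteq> D"
    then have "{\<sigma> \<in> {\<sigma> \<in> F. d \<in> \<sigma>}. \<sigma> \<inter> D = E} = {\<sigma> \<in> F. \<sigma> \<inter> insert d D = insert d E}"
      using insert.hyps by auto
    then show "erasable {\<sigma> \<in> {\<sigma> \<in> F. d \<in> \<sigma>}. \<sigma> \<inter> D = E}"
      using insert.prems[of "insert d E"] \<open>E \<subseteq> D\<close> by auto
  qed
  ultimately have "erasable ({\<sigma> \<in> F. d \<notin> \<sigma>} \<union> {\<sigma> \<in> F. d \<in> \<sigma>})"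
    by (rule erasable.union) auto
  moreover have "{\<sigma> \<in> F. d \<notin> \<sigma>} \<union> {\<sigma> \<in> F. d \<in> \<sigma>} = F" by auto
  ultimately show ?case by simp
qed

lemma realization_vertex: "realization {{}, {v}} = {\<lambda>w. if w = v then 1 else 0}"
proof -
  have "x = (\<lambda>w. if w = v then 1 else 0)" if "x \<in> realization {{}, {v}}" for x
  proof -
    have "{w. x w \<noteq> 0} \<noteq> {}" using that by (auto simp: realization_def)
    then have "{w. x w \<noteq> 0} = {v}" using realization_support[OF that] by auto
    moreover from this have "x v = 1" using that by (simp add: realization_def)
    ultimately show ?thesis by fastforce
  qed
  moreover have "(\<lambda>w. if w = v then 1 else 0) \<in> realization {{}, {v}}"
    by (simp add: realization_def)
  ultimately show ?thesis by blast
qed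

text \<open>
  The induction over \<open>erasable\<close> needs a statement about the removal of \<open>F\<close> from a larger complex.
  The last pair may consist of a vertex and the empty simplex; what remains then is the complex
  without simplices, whence the case distinction on \<open>K - F\<close>.
\<close>

lemma contractible_if_erasable_diff:
  assumes "erasable F" "F \<subseteq> K" "finite_complex K" "finite_complex (K - F)"
    and "K - F \<noteq> {} \<Longrightarrow> realization (K - F) \<noteq> {} \<and> contractible (realization (K - F))"
    and "K \<noteq> {}"
  shows "realization K \<noteq> {} \<and> contractible (realization K)"
  using assms
proof (induction F arbitrary: K rule: erasable.induct)
  case empty
  then show ?case by simp
next
  case (pair v \<sigma>)
  let ?F = "{\<sigma>, insert v \<sigma>}"
  show ?case
  proof (cases "\<sigma> = {}")
    case True
    have "K - ?F = {}"
      using pair.prems(3) True unfolding finite_complex_def by blast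
    then have "K = {{}, {v}}" using pair.prems True by auto
    then show ?thesis
      unfolding contractible_space_top_of_set[symmetric] realization_vertex
      using contractible_space_subtopology_singleton realization_vertex[of v] by simp
  next
    case False
    then have "{} \<in> K - ?F"
      using pair.prems(1,2) by (auto simp: finite_complex_def)
    then have "realization (K - ?F) \<noteq> {} \<and> contractible (realization (K - ?F))"
      using pair.prems(4) by blast
    moreover have "realization (K - ?F) \<subseteq> realization K"
      by (rule realization_subset) auto
    ultimately show ?thesis
      using elementary_collapse_contractible[OF pair.prems(2,3) refl False pair.hyps] pair.prems(1) by auto
  qed
next
  case (union A B)
  have eq: "K - B - A = K - (A \<union> B)" by auto
  have "finite_complex (K - B)"
  proof (rule finite_complex_diff[OF union.prems(2)])
    fix \<sigma> \<tau> assume \<sigma>: "\<sigma> \<in> B" "\<tau> \<in> K" "\<sigma> \<subseteq> \<tau>"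
    then have "\<tau> \<notin> A" using union.hyps by blast
    moreover have "\<tau> \<notin> K - (A \<union> B)"
      using \<sigma> finite_complex_down[OF union.prems(3)] by blast
    ultimately show "\<tau> \<in> B" using \<sigma> by auto
  qed
  moreover have "A \<subseteq> K - B"
    using union.prems(1) union.hyps(3) by blast
  ultimately have "realization (K - B) \<noteq> {} \<and> contractible (realization (K - B))" if "K - B \<noteq> {}"
    using union.IH(1)[of "K - B"] union.prems that unfolding eq by blast
  with \<open>finite_complex (K - B)\<close> show ?case
    using union.IH(2)[of K] union.prems by blast
qed

theorem erasable_imp_contractible:
  assumes "erasable K" "finite_complex K" "K \<noteq> {}"
  shows "realization K \<noteq> {}" "contractible (realization K)"
  using contractible_if_erasable_diff[OF assms(1) order_refl assms(2)] assms(3)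
  by (auto simp: finite_complex_def)

section \<open>Contracting the complement of a set of facets\<close>

lemma realization_Pow:
  assumes "finite F"
  shows "realization (Pow F) = {x. (\<forall>v. 0 \<le> x v) \<and> (\<forall>v. v \<notin> F \<longrightarrow> x v = 0) \<and> sum x F = 1}"
  using realization_iff[OF assms] by (auto simp: realization_def) 

lemma closed_realization_Pow:
  assumes "finite F"
  shows "closed (realization (Pow F))"
  unfolding realization_Pow[OF assms]
  by (intro closed_Collect_conj closed_Collect_all closed_Collect_imp closed_Collect_le closed_Collect_eq
      continuous_intros open_Collect_const)

lemma compact_realization_Pow:
  assumes "finite F"
  shows "compact (realization (Pow F))"
proof -
  have "compactin (product_topology (\<lambda>_. euclidean) UNIV) (PiE UNIV (\<lambda>_. {0..1::real}))"
    by (simp add: compactin_PiE)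
  then have "compact (PiE UNIV (\<lambda>_. {0..1}) :: ('a \<Rightarrow> real) set)"
    by (simp add: euclidean_product_topology)
  moreover have "realization (Pow F) \<subseteq> PiE UNIV (\<lambda>_. {0..1})"
  proof
    fix x assume x: "x \<in> realization (Pow F)"
    have "x v \<le> 1" for v
    proof (cases "v \<in> F")
      case True
      then have "x v \<le> sum x F"
        using x assms by (intro member_le_sum) (auto simp: realization_Pow)
      then show ?thesis using x by (simp add: realization_Pow assms)
    qed (use x in \<open>simp add: realization_Pow assms\<close>)
    then show "x \<in> PiE UNIV (\<lambda>_. {0..1})" using x by (auto simp: realization_def)
  qed
  ultimately have "compact (PiE UNIV (\<lambda>_. {0..1}) \<inter> realization (Pow F))"
    using closed_realization_Pow[OF assms] by (simp add: compact_Int_closed)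
  then show ?thesis using \<open>realization (Pow F) \<subseteq> _\<close> by (simp add: Int_absorb1)
qed

lemma realization_eq_Union:
  assumes "finite_complex K"
  shows "realization K = (\<Union>\<sigma>\<in>K. realization (Pow \<sigma>))"
  using finite_complex_down[OF assms] by (auto simp: realization_def)

lemma closed_realization:
  assumes "finite_complex K"
  shows "closed (realization K)"
  unfolding realization_eq_Union[OF assms]
  using assms by (intro closed_UN ballI closed_realization_Pow) (auto simp: finite_complex_def)

text \<open>
  \<open>K\<close> is obtained from the complex \<open>K - C\<close> by attaching the \<open>q\<close>-simplices in \<open>C\<close> along their boundaries.
\<close>

locale attached_facets =
  fixes K C :: "'v set set" and q :: nat
  assumes complex: "finite_complex K"
    and C_subset: "C \<subseteq> K"
    and facet: "\<sigma> \<in> C \<Longrightarrow> \<tau> \<in> K \<Longrightarrow> \<sigma> \<subseteq> \<tau> \<Longrightarrow> \<tau> = \<sigma>"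
    and card_facet: "\<sigma> \<in> C \<Longrightarrow> card \<sigma> = Suc q"
begin

lemma finite_C: "finite C"
  using C_subset complex finite_complex_finite finite_subset by blast

lemma finite_facet: "\<sigma> \<in> C \<Longrightarrow> finite \<sigma>"
  using card_facet card.infinite by fastforce

lemma facet_nonempty: "\<sigma> \<in> C \<Longrightarrow> \<sigma> \<noteq> {}"
  using card_facet by fastforce

lemma L_complex: "finite_complex (K - C)"
  using finite_complex_diff[OF complex] facet by blast

text \<open>
  The least coordinate of \<open>x\<close> on the facet \<open>\<sigma>\<close> is positive exactly in the interior of the facet, and it is
  \<open>1 / (q + 1)\<close> at the barycentre. Since at most one summand is nonzero, \<open>height\<close> and \<open>slab\<close> describe the
  facet that contains \<open>x\<close> in its interior by formulas that are continuous on the whole realization.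
  For \<open>\<theta>\<close> from \<open>0\<close> to \<open>1\<close>, the point \<open>push \<theta> x\<close> moves away from the barycentre of that facet, from \<open>x\<close> to the
  radial projection of \<open>x\<close> to the boundary.
\<close>

definition low :: "'v set \<Rightarrow> ('v \<Rightarrow> real) \<Rightarrow> real" where
  "low \<sigma> x = Min (x ` \<sigma>)"

definition height :: "('v \<Rightarrow> real) \<Rightarrow> real" where
  "height x = (\<Sum>\<sigma>\<in>C. low \<sigma> x)"

definition slab :: "('v \<Rightarrow> real) \<Rightarrow> 'v \<Rightarrow> real" where
  "slab x v = (\<Sum>\<sigma>\<in>C. if v \<in> \<sigma> then low \<sigma> x else 0)"

definition push :: "real \<Rightarrow> ('v \<Rightarrow> real) \<Rightarrow> 'v \<Rightarrow> real" where
  "push \<theta> x v = (x v - \<theta> * slab x v) / (1 - \<theta> * (real (Suc q) * height x))"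

lemma low_le: "\<sigma> \<in> C \<Longrightarrow> v \<in> \<sigma> \<Longrightarrow> low \<sigma> x \<le> x v"
  unfolding low_def using finite_facet by simp

lemma low_eq_0_iff:
  assumes "\<sigma> \<in> C" "x \<in> realization K"
  shows "low \<sigma> x = 0 \<longleftrightarrow> {v. x v \<noteq> 0} \<noteq> \<sigma>" "low \<sigma> x \<ge> 0"
proof -
  have "low \<sigma> x \<in> x ` \<sigma>"
    unfolding low_def using assms finite_facet facet_nonempty by (intro Min_in) auto
  then obtain w where w: "w \<in> \<sigma>" "x w = low \<sigma> x" by auto
  then show nonneg: "low \<sigma> x \<ge> 0" using assms(2) by (metis realization_nonneg)
  have "\<exists>v\<in>\<sigma>. x v = 0" if "{v. x v \<noteq> 0} \<noteq> \<sigma>"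
    using facet[OF assms(1) realization_support[OF assms(2)]] that by auto
  then have "low \<sigma> x = 0" if "{v. x v \<noteq> 0} \<noteq> \<sigma>"
    using that low_le[OF assms(1)] nonneg by (metis order_antisym)
  then show "low \<sigma> x = 0 \<longleftrightarrow> {v. x v \<noteq> 0} \<noteq> \<sigma>" using w by auto
qed

lemma height_slab_off:
  assumes "x \<in> realization (K - C)"
  shows "height x = 0" "slab x = (\<lambda>v. 0)" "push \<theta> x = x"
proof -
  have "low \<sigma> x = 0" if "\<sigma> \<in> C" for \<sigma>
    using that assms realization_support[OF assms] realization_subset[of "K - C" K]
    by (subst low_eq_0_iff) auto
  then show *: "height x = 0" "slab x = (\<lambda>v. 0)"
    unfolding height_def slab_def by (auto intro!: sum.neutral)
  show "push \<theta> x = x" by (rule ext) (simp add: push_def *)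
qed

lemma height_slab_on:
  assumes "x \<in> realization K" "\<sigma> \<in> C" "{v. x v \<noteq> 0} = \<sigma>"
  shows "height x = low \<sigma> x" "slab x v = (if v \<in> \<sigma> then low \<sigma> x else 0)"
proof -
  have z: "low \<tau> x = 0" if "\<tau> \<in> C - {\<sigma>}" for \<tau>
    using that assms by (subst low_eq_0_iff) auto
  have "height x = low \<sigma> x + (\<Sum>\<tau>\<in>C - {\<sigma>}. low \<tau> x)"
    unfolding height_def using finite_C assms(2) by (rule sum.remove)
  then show "height x = low \<sigma> x" using z by simp
  have "slab x v = (if v \<in> \<sigma> then low \<sigma> x else 0) + (\<Sum>\<tau>\<in>C - {\<sigma>}. if v \<in> \<tau> then low \<tau> x else 0)"
    unfolding slab_def using finite_C assms(2) by (rule sum.remove)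
  also have "(\<Sum>\<tau>\<in>C - {\<sigma>}. if v \<in> \<tau> then low \<tau> x else 0) = 0"
    by (rule sum.neutral) (use z in auto)
  finally show "slab x v = (if v \<in> \<sigma> then low \<sigma> x else 0)" by simp
qed

lemma height_bounds:
  assumes "x \<in> realization K"
  shows "0 \<le> height x" "real (Suc q) * height x \<le> 1"
proof -
  show "0 \<le> height x"
    unfolding height_def by (rule sum_nonneg) (use low_eq_0_iff assms in auto)
  show "real (Suc q) * height x \<le> 1"
  proof (cases "{v. x v \<noteq> 0} \<in> C")
    case False
    then have "x \<in> realization (K - C)" using assms by (auto simp: realization_def)
    then show ?thesis by (simp add: height_slab_off)
  next
    case True
    define \<sigma> where "\<sigma> = {v. x v \<noteq> 0}"
    have "real (Suc q) * height x = (\<Sum>v\<in>\<sigma>. low \<sigma> x)"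
      using height_slab_on[OF assms True refl] card_facet[OF True] by (simp add: \<sigma>_def)
    also have "\<dots> \<le> sum x \<sigma>" by (rule sum_mono) (use low_le True \<sigma>_def in auto)
    also have "\<dots> = 1" using assms by (simp add: realization_def \<sigma>_def)
    finally show ?thesis .
  qed
qed

lemma push_in:
  assumes x: "x \<in> realization K" and \<theta>: "0 \<le> \<theta>" "\<theta> \<le> 1" "\<theta> * (real (Suc q) * height x) < 1"
  shows "push \<theta> x \<in> realization K" "\<theta> = 1 \<Longrightarrow> push \<theta> x \<in> realization (K - C)"
proof -
  have "push \<theta> x \<in> realization K \<and> (\<theta> = 1 \<longrightarrow> push \<theta> x \<in> realization (K - C))"
  proof (cases "{v. x v \<noteq> 0} \<in> C")
    case False
    then have "x \<in> realization (K - C)" using x by (auto simp: realization_def)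
    then show ?thesis using x by (simp add: height_slab_off)
  next
    case True
    define \<sigma> where "\<sigma> = {v. x v \<noteq> 0}"
    note on = height_slab_on[OF x True refl, folded \<sigma>_def]
    have fin: "finite \<sigma>" and \<sigma>C: "\<sigma> \<in> C" using finite_facet True \<sigma>_def by auto
    have eq: "push \<theta> x v = (x v - \<theta> * (if v \<in> \<sigma> then low \<sigma> x else 0)) / (1 - \<theta> * (real (Suc q) * height x))" for v
      by (simp add: push_def on)
    have nonneg: "0 \<le> push \<theta> x v" for v
    proof -
      have "\<theta> * (if v \<in> \<sigma> then low \<sigma> x else 0) \<le> (if v \<in> \<sigma> then low \<sigma> x else 0)"
        using \<theta> low_eq_0_iff(2)[OF \<sigma>C x] by (auto simp: mult_left_le_one_le)
      also have "\<dots> \<le> x v" using low_le[OF \<sigma>C] realization_nonneg[OF x] by auto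
      finally show ?thesis unfolding eq using \<theta> by simp
    qed
    have supp: "{v. push \<theta> x v \<noteq> 0} \<subseteq> \<sigma>" unfolding eq \<sigma>_def by auto
    have "sum (push \<theta> x) \<sigma> = (\<Sum>v\<in>\<sigma>. x v - \<theta> * low \<sigma> x) / (1 - \<theta> * (real (Suc q) * height x))"
      unfolding eq sum_divide_distrib by (rule sum.cong) auto
    also have "(\<Sum>v\<in>\<sigma>. x v - \<theta> * low \<sigma> x) = 1 - \<theta> * (real (Suc q) * height x)"
      using x card_facet[OF \<sigma>C] on by (simp add: sum_subtractf realization_def \<sigma>_def)
    finally have sum1: "sum (push \<theta> x) \<sigma> = 1" using \<theta> by simp
    have inK: "{v. push \<theta> x v \<noteq> 0} \<in> K"
      using supp \<sigma>C C_subset finite_complex_down[OF complex] by blast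
    have "{v. push \<theta> x v \<noteq> 0} \<in> K - C" if "\<theta> = 1"
    proof -
      have "low \<sigma> x \<in> x ` \<sigma>"
        unfolding low_def using fin facet_nonempty[OF \<sigma>C] by (intro Min_in) auto
      then obtain w where w: "w \<in> \<sigma>" "x w = low \<sigma> x" by auto
      then have "push \<theta> x w = 0" unfolding eq using that by simp
      then have "{v. push \<theta> x v \<noteq> 0} \<noteq> \<sigma>" using w by auto
      moreover have "{v. push \<theta> x v \<noteq> 0} = \<sigma>" if "{v. push \<theta> x v \<noteq> 0} \<in> C"
        using facet[OF that] supp \<sigma>C C_subset by blast
      ultimately show ?thesis using inK by blast
    qed
    then show ?thesis
      using realization_iff[OF fin supp] nonneg sum1 inK by auto
  qed
  then show "push \<theta> x \<in> realization K" "\<theta> = 1 \<Longrightarrow> push \<theta> x \<in> realization (K - C)" by auto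
qed

lemma continuous_on_height [continuous_intros]:
  "continuous_on S f \<Longrightarrow> continuous_on S (\<lambda>x. height (f x))"
  unfolding height_def low_def
  by (intro continuous_on_sum continuous_on_Min_image finite_facet facet_nonempty)

lemma continuous_on_slab [continuous_intros]:
  "continuous_on S f \<Longrightarrow> continuous_on S (\<lambda>x. slab (f x) v)"
  unfolding slab_def low_def
proof (intro continuous_on_sum, goal_cases)
  case (1 \<sigma>)
  then show ?case
    by (cases "v \<in> \<sigma>") (auto intro!: continuous_on_Min_image finite_facet facet_nonempty)
qed

lemma continuous_on_push:
  assumes "continuous_on S \<theta>" "continuous_on S f"
    and "\<And>x. x \<in> S \<Longrightarrow> \<theta> x * (real (Suc q) * height (f x)) \<noteq> 1"
  shows "continuous_on S (\<lambda>x. push (\<theta> x) (f x))"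
proof (rule continuous_on_coordinatewise_then_product)
  fix v
  show "continuous_on S (\<lambda>x. push (\<theta> x) (f x) v)"
    unfolding push_def using assms(3)
    by (intro continuous_on_divide continuous_on_diff continuous_on_mult continuous_on_const
        continuous_on_height continuous_on_slab assms(1,2)
        continuous_on_product_then_coordinatewise[OF assms(2)]) fastforce
qed

text \<open>
  This is the homotopy extension property of the pair, made explicit for a contraction of the
  subcomplex. First the inner half of each facet is stretched over the whole facet and the outer half
  is projected to the boundary. Then the outer half, whose image now lies in the subcomplex, is dragged
  along the contraction, for a time that grows from \<open>0\<close> in the middle of the radius to \<open>1\<close> at the
  boundary. The subcomplex is preserved all the time.
\<close>

lemma squeeze:
  assumes "contractible (realization (K - C))"
  obtains E c where
    "homotopic_with (\<lambda>f. f ` realization (K - C) \<subseteq> realization (K - C))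
      (top_of_set (realization K)) (top_of_set (realization K)) id E"
    "\<And>x. x \<in> realization (K - C) \<Longrightarrow> E x = c"
proof -
  let ?R = "realization K" and ?L = "realization (K - C)" and ?n = "real (Suc q)"
  let ?hom = "homotopic_with (\<lambda>f. f ` ?L \<subseteq> ?L) (top_of_set ?R) (top_of_set ?R)"
  have LR: "?L \<subseteq> ?R" by (rule realization_subset) auto
  have P_cong: "(f ` ?L \<subseteq> ?L) = (g ` ?L \<subseteq> ?L)" if "\<And>x. x \<in> ?R \<Longrightarrow> f x = g x" for f g
    using that LR by (metis image_cong subsetD)
  obtain H :: "real \<times> ('v \<Rightarrow> real) \<Rightarrow> 'v \<Rightarrow> real" and c where H: "continuous_on ({0..1} \<times> ?L) H"
      and H_in: "H ` ({0..1} \<times> ?L) \<subseteq> ?L" and H0: "\<And>x. H (0, x) = x" and H1: "\<And>x. H (1, x) = c"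
    using assms unfolding contractible_def homotopic_with_def by (auto simp: image_subset_iff Pi_iff)
  (* The factor is 1 on the outer half of a facet and 0 at the barycentre, the only point where
     pushing completely to the boundary is impossible. *)
  define \<theta> where "\<theta> x = min 1 (2 - 2 * (?n * height x))" for x
  have \<theta>: "0 \<le> \<theta> x" "\<theta> x \<le> 1" "0 \<le> u \<Longrightarrow> u \<le> 1 \<Longrightarrow> u * \<theta> x * (?n * height x) < 1" if "x \<in> ?R" for x u
  proof -
    show t: "0 \<le> \<theta> x" "\<theta> x \<le> 1" using height_bounds[OF that] by (auto simp: \<theta>_def)
    assume u: "0 \<le> u" "u \<le> 1"
    show "u * \<theta> x * (?n * height x) < 1"
    proof (cases "?n * height x < 1")
      case True
      have "u * \<theta> x \<le> 1" using u t by (simp add: mult_le_one)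
      then have "u * \<theta> x * (?n * height x) \<le> 1 * (?n * height x)"
        using height_bounds[OF that] by (intro mult_right_mono) auto
      then show ?thesis using True by (simp only: mult_1_left)
    next
      case False
      then have "?n * height x = 1" using height_bounds(2)[OF that] by linarith
      then have "\<theta> x = 0" unfolding \<theta>_def by simp
      then show ?thesis by simp
    qed
  qed
  define \<psi> where "\<psi> x = push (\<theta> x) x" for x
  have \<theta>_cont: "continuous_on S (\<lambda>x. \<theta> (f x))" if "continuous_on S f" for f :: "'b::topological_space \<Rightarrow> _" and S
    unfolding \<theta>_def by (intro continuous_on_min continuous_on_diff continuous_on_mult
        continuous_on_const continuous_on_height that)
  have \<psi>_in: "\<psi> x \<in> ?R" if "x \<in> ?R" for x
    unfolding \<psi>_def using push_in(1)[OF that \<theta>(1,2)] \<theta>(3)[of x 1] that by simp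
  have \<psi>_L: "\<psi> x \<in> ?L" if "x \<in> ?R" "?n * height x \<le> 1 / 2" for x
    unfolding \<psi>_def using push_in(2)[OF that(1) \<theta>(1,2)] \<theta>(3)[of x 1] that by (simp add: \<theta>_def)
  have \<psi>_cont: "continuous_on ?R \<psi>"
    unfolding \<psi>_def using \<theta>(3)[of _ 1]
    by (intro continuous_on_push \<theta>_cont continuous_on_id) force
  have 1: "?hom id \<psi>"
  proof (rule homotopic_with_top_of_setI[where h = "\<lambda>u x. push (u * \<theta> x) x", OF _ _ _ _ _ P_cong])
    show "continuous_on ({0..1} \<times> ?R) (\<lambda>(u, x). push (u * \<theta> x) x)"
      unfolding case_prod_beta
      using \<theta>(3) by (intro continuous_on_push continuous_intros \<theta>_cont) force
    show "push (u * \<theta> x) x \<in> ?R" if "0 \<le> u" "u \<le> 1" "x \<in> ?R" for u x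
      using that \<theta> by (intro push_in) (auto intro: mult_le_one)
    show "(\<lambda>x. push (u * \<theta> x) x) ` ?L \<subseteq> ?L" for u
      by (auto simp: height_slab_off)
  qed (auto simp: \<psi>_def push_def)
  (* On the outer half, psi projects to the boundary, so H applies; at the middle radius its
     time argument is 0. *)
  define G where "G u x = (if ?n * height x \<le> 1 / 2 then H (u * (1 - 2 * (?n * height x)), \<psi> x) else \<psi> x)" for u x
  have H_arg: "(u * (1 - 2 * (?n * height x)), \<psi> x) \<in> {0..1} \<times> ?L"
    if "0 \<le> u" "u \<le> 1" "x \<in> ?R" "?n * height x \<le> 1 / 2" for u x
    using that \<psi>_L[OF that(3,4)] height_bounds(1)[OF that(3)] by (auto intro!: mult_le_one)
  have 2: "?hom \<psi> (G 1)"
  proof (rule homotopic_with_top_of_setI[where h = G, OF _ _ _ _ _ P_cong])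
    have \<psi>_cont2: "continuous_on S (\<lambda>p. \<psi> (snd p))" if "S \<subseteq> {0..1::real} \<times> ?R" for S
      using that by (intro continuous_on_compose2[OF \<psi>_cont] continuous_intros) auto
    show "continuous_on ({0..1} \<times> ?R) (\<lambda>(u, x). G u x)"
      unfolding G_def case_prod_beta
    proof (rule continuous_on_cases_le)
      show "continuous_on {p \<in> {0..1} \<times> ?R. ?n * height (snd p) \<le> 1 / 2}
          (\<lambda>p. H (fst p * (1 - 2 * (?n * height (snd p))), \<psi> (snd p)))"
        using H_arg by (intro continuous_on_compose2[OF H] continuous_intros \<psi>_cont2) force+
      show "continuous_on {p \<in> {0..1::real} \<times> ?R. 1 / 2 \<le> ?n * height (snd p)} (\<lambda>p. \<psi> (snd p))"
        by (rule \<psi>_cont2) auto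
      show "continuous_on ({0..1::real} \<times> ?R) (\<lambda>p. ?n * height (snd p))"
        by (intro continuous_intros)
      show "H (fst p * (1 - 2 * (?n * height (snd p))), \<psi> (snd p)) = \<psi> (snd p)"
        if "?n * height (snd p) = 1 / 2" for p
        by (simp only: that) (simp add: H0)
    qed
    show "G u x \<in> ?R" if "0 \<le> u" "u \<le> 1" "x \<in> ?R" for u x
      using that H_arg[OF that] H_in \<psi>_in[OF that(3)] LR unfolding G_def by force
    show "G u ` ?L \<subseteq> ?L" if "0 \<le> u" "u \<le> 1" for u
      using that H_in by (auto simp: G_def \<psi>_def height_slab_off)
  qed (auto simp: G_def H0)
  show thesis
  proof (rule that)
    show "?hom id (G 1)" using 1 2 by (rule homotopic_with_trans)
    show "G 1 x = c" if "x \<in> ?L" for x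
      using that by (simp add: G_def height_slab_off H1)
  qed
qed

end

section \<open>Quotients and spheres\<close>

lemma contractible_nonempty_imp_point:
  assumes "contractible S" "S \<noteq> {}"
  shows "top_of_set S homotopy_equivalent_space discrete_topology {()}"
proof -
  have "top_of_set S \<noteq> trivial_topology"
    using assms(2) by (metis null_topspace_iff_trivial topspace_euclidean_subtopology)
  then obtain a where a: "a \<in> S" "top_of_set S homotopy_equivalent_space subtopology (top_of_set S) {a}"
    using assms(1) contractible_eq_homotopy_equivalent_singleton_subtopology[of "top_of_set S"] by auto
  have "subtopology (top_of_set S) {a} = discrete_topology {a}"
    using a(1) by (intro subtopology_eq_discrete_topology_sing[THEN iffD2]) auto
  moreover have "homeomorphic_maps (discrete_topology {a}) (discrete_topology {()}) (\<lambda>_. ()) (\<lambda>_. a)"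
    by (auto simp: homeomorphic_maps_def)
  ultimately have "subtopology (top_of_set S) {a} homotopy_equivalent_space discrete_topology {()}"
    using homeomorphic_imp_homotopy_equivalent_space homeomorphic_space_def by metis
  with a(2) show ?thesis by (rule homotopy_eqv_trans)
qed

text \<open>
  This is the argument that collapsing a contractible subspace with the homotopy extension property
  does not change the homotopy type. The end \<open>E\<close> of the deformation factors through the quotient, which
  gives the homotopy inverse of \<open>g\<close>. As \<open>[0, 1]\<close> is locally compact, \<open>id \<times> g\<close> is a quotient map too,
  and so the deformation itself also descends to the quotient.
\<close>

lemma homotopy_equivalent_quotient:
  assumes q: "quotient_map X Y g"
    and hom: "homotopic_with P X X id E"
    and P: "\<And>f x y. P f \<Longrightarrow> x \<in> topspace X \<Longrightarrow> y \<in> topspace X \<Longrightarrow> g x = g y \<Longrightarrow> g (f x) = g (f y)"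
    and E: "\<And>x y. x \<in> topspace X \<Longrightarrow> y \<in> topspace X \<Longrightarrow> g x = g y \<Longrightarrow> E x = E y"
  shows "X homotopy_equivalent_space Y"
proof -
  let ?I = "top_of_set {0..1::real}"
  have g: "continuous_map X Y g" "g ` topspace X = topspace Y"
    using q by (auto simp: quotient_imp_continuous_map quotient_imp_surjective_map)
  have E_cont: "continuous_map X X E" using homotopic_with_imp_continuous_maps[OF hom] by simp
  obtain f where f: "continuous_map Y X f" "\<And>x. x \<in> topspace X \<Longrightarrow> f (g x) = E x"
    by (rule quotient_map_lift_exists[OF q E_cont]) (use E in blast)+
  have "homotopic_with (\<lambda>_. True) X X E (f \<circ> g)"
    using E_cont f by (intro homotopic_with_equal) auto
  then have fg: "homotopic_with (\<lambda>_. True) X X (f \<circ> g) id"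
    using homotopic_with_mono[OF hom] homotopic_with_trans homotopic_with_symD by metis
  obtain h where h: "continuous_map (prod_topology ?I X) X h" "\<And>x. h (0, x) = x" "\<And>x. h (1, x) = E x"
    and h_P: "\<And>u. u \<in> {0..1} \<Longrightarrow> P (\<lambda>x. h (u, x))"
    using hom unfolding homotopic_with_def by auto
  have "quotient_map (prod_topology ?I X) (prod_topology ?I Y) (\<lambda>(u, x). (u, g x))"
    using q by (intro quotient_map_prod_right compact_imp_locally_compact_space)
      (auto simp: compact_space_subtopology Hausdorff_space_subtopology)
  moreover have "continuous_map (prod_topology ?I X) Y (g \<circ> h)"
    using h(1) g(1) by (rule continuous_map_compose)
  moreover have "(g \<circ> h) a = (g \<circ> h) b"
    if ab: "a \<in> topspace (prod_topology ?I X)" "b \<in> topspace (prod_topology ?I X)"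
      "(\<lambda>(u, x). (u, g x)) a = (\<lambda>(u, x). (u, g x)) b" for a b
  proof -
    obtain u x u' y where eq: "a = (u, x)" "b = (u', y)" by (metis surj_pair)
    have "u' = u" "u \<in> {0..1}" "x \<in> topspace X" "y \<in> topspace X" "g x = g y"
      using ab unfolding eq by simp_all
    then have "g (h (u, x)) = g (h (u, y))" using P[OF h_P] by blast
    with \<open>u' = u\<close> show ?thesis by (simp add: eq)
  qed
  ultimately obtain k where k: "continuous_map (prod_topology ?I Y) Y k"
    "\<And>a. a \<in> topspace (prod_topology ?I X) \<Longrightarrow> k ((\<lambda>(u, x). (u, g x)) a) = (g \<circ> h) a"
    by (rule quotient_map_lift_exists) (assumption+, rule that)
  have k_g: "k (u, g x) = g (h (u, x))" if "0 \<le> u" "u \<le> 1" "x \<in> topspace X" for u x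
    using that k(2)[of "(u, x)"] by simp
  have "k (0, y) = y \<and> k (1, y) = g (f y)" if y: "y \<in> topspace Y" for y
  proof -
    obtain x where "x \<in> topspace X" "y = g x" using g(2) y by auto
    then show ?thesis using k_g[of 0 x] k_g[of 1 x] h f by simp
  qed
  then have "homotopic_with (\<lambda>_. True) Y Y id (g \<circ> f)"
    using k(1) by (subst homotopic_with) auto
  then have "homotopic_with (\<lambda>_. True) Y Y (g \<circ> f) id" by (rule homotopic_with_symD)
  with f g fg show ?thesis unfolding homotopy_equivalent_space_def by blast
qed

text \<open>
  This map from the standard simplex collapses its boundary to the base point. In the interior, the
  vector of the quotients \<open>(y i - y 0) / a\<close> for \<open>1 \<le> i \<le> q\<close>, where \<open>a\<close> is the least coordinate, ranges over
  \<open>q\<close>-dimensional space, which the inverse of the stereographic projection takes to the sphere minus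
  its base point. Clearing denominators makes the formula meaningful, and continuous, for \<open>a = 0\<close> as well.
\<close>

definition simplex_to_sphere :: "nat \<Rightarrow> (nat \<Rightarrow> real) \<Rightarrow> nat \<Rightarrow> real" where
  "simplex_to_sphere q y = (let a = Min (y ` {..q}); D = (\<Sum>i\<le>q. (y i - y 0)\<^sup>2) in
     (\<lambda>i. if i = 0 then (D - a\<^sup>2) / (D + a\<^sup>2) else if i \<le> q then 2 * a * (y i - y 0) / (D + a\<^sup>2) else 0))"

definition sphere_set :: "nat \<Rightarrow> (nat \<Rightarrow> real) set" where
  "sphere_set q = {z. (\<Sum>i\<le>q. (z i)\<^sup>2) = 1 \<and> (\<forall>i>q. z i = 0)}"

definition sphere_base :: "nat \<Rightarrow> real" where
  "sphere_base = (\<lambda>n. if n = 0 then 1 else 0)"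

lemma nsphere_eq: "nsphere q = top_of_set (sphere_set q)"
  by (simp add: nsphere sphere_set_def euclidean_product_topology)

lemma closed_sphere_set: "closed (sphere_set q)"
  unfolding sphere_set_def
  by (intro closed_Collect_conj closed_Collect_all closed_Collect_imp closed_Collect_eq
      continuous_intros open_Collect_const)

text \<open>
  The coordinate \<open>0\<close> of the sphere is the axis of the stereographic projection.
\<close>

lemma sum_split_0: "(\<Sum>i\<le>q. f i) = f 0 + (\<Sum>i\<in>{1..q}. f i)" for f :: "nat \<Rightarrow> real"
  by (metis atMost_atLeast0 One_nat_def sum.atLeast_Suc_atMost zero_le)

context
  fixes q :: nat and y :: "nat \<Rightarrow> real"
  assumes y_nonneg: "\<And>i. i \<le> q \<Longrightarrow> 0 \<le> y i" and y_sum: "(\<Sum>i\<le>q. y i) = 1"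
begin

private definition "a = Min (y ` {..q})"
private definition "D = (\<Sum>i\<le>q. (y i - y 0)\<^sup>2)"

private lemma a_le: "i \<le> q \<Longrightarrow> a \<le> y i" unfolding a_def by simp
private lemma a_nonneg: "0 \<le> a" unfolding a_def using y_nonneg by simp
private lemma D_nonneg: "0 \<le> D" unfolding D_def by (intro sum_nonneg) simp

private lemma den_pos: "0 < D + a\<^sup>2"
proof (rule ccontr)
  assume "\<not> 0 < D + a\<^sup>2"
  then have "D = 0" "a\<^sup>2 = 0" using D_nonneg zero_le_power2[of a] by linarith+
  then have "a = 0" by simp
  have const: "y i = y 0" if "i \<le> q" for i
  proof -
    have "(y i - y 0)\<^sup>2 \<le> D"
      unfolding D_def using that by (intro member_le_sum) simp_all
    then show ?thesis using \<open>D = 0\<close> by simp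
  qed
  have "a \<in> y ` {..q}" unfolding a_def by (intro Min_in) auto
  then obtain i where "i \<le> q" "y i = 0" using \<open>a = 0\<close> by auto
  then have "y 0 = 0" using const[OF \<open>i \<le> q\<close>] by simp
  have "(\<Sum>i\<le>q. y i) = (\<Sum>i\<le>q. 0)"
    by (rule sum.cong[OF refl]) (use trans[OF const \<open>y 0 = 0\<close>] in blast)
  then show False using y_sum by simp
qed

private lemma simplex_to_sphere_eq:
  "simplex_to_sphere q y = (\<lambda>i. if i = 0 then (D - a\<^sup>2) / (D + a\<^sup>2)
     else if i \<le> q then 2 * a * (y i - y 0) / (D + a\<^sup>2) else 0)"
  unfolding simplex_to_sphere_def Let_def a_def D_def ..

lemma simplex_to_sphere_denominator: "0 < (\<Sum>i\<le>q. (y i - y 0)\<^sup>2) + (Min (y ` {..q}))\<^sup>2"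
  using den_pos unfolding a_def D_def .

lemma simplex_to_sphere_in: "simplex_to_sphere q y \<in> sphere_set q"
proof -
  have D: "D = (\<Sum>i\<in>{1..q}. (y i - y 0)\<^sup>2)" unfolding D_def sum_split_0 by simp
  have "(\<Sum>i\<le>q. (simplex_to_sphere q y i)\<^sup>2) =
      ((D - a\<^sup>2) / (D + a\<^sup>2))\<^sup>2 + (\<Sum>i\<in>{1..q}. (2 * a * (y i - y 0) / (D + a\<^sup>2))\<^sup>2)"
    unfolding sum_split_0 simplex_to_sphere_eq by simp
  also have "(\<Sum>i\<in>{1..q}. (2 * a * (y i - y 0) / (D + a\<^sup>2))\<^sup>2) = (2 * a / (D + a\<^sup>2))\<^sup>2 * D"
    unfolding D sum_distrib_left by (rule sum.cong) (auto simp: power_mult_distrib power_divide)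
  also have "((D - a\<^sup>2) / (D + a\<^sup>2))\<^sup>2 + (2 * a / (D + a\<^sup>2))\<^sup>2 * D = ((D - a\<^sup>2)\<^sup>2 + 4 * a\<^sup>2 * D) / (D + a\<^sup>2)\<^sup>2"
    by (simp add: power_divide power_mult_distrib add_divide_distrib)
  also have "(D - a\<^sup>2)\<^sup>2 + 4 * a\<^sup>2 * D = (D + a\<^sup>2)\<^sup>2"
    by (simp add: power2_eq_square algebra_simps)
  finally show ?thesis using den_pos unfolding sphere_set_def by (simp add: simplex_to_sphere_eq)
qed

lemma simplex_to_sphere_eq_base: "simplex_to_sphere q y = sphere_base \<longleftrightarrow> Min (y ` {..q}) = 0"
proof
  assume "simplex_to_sphere q y = sphere_base"
  then have "simplex_to_sphere q y 0 = sphere_base 0" by simp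
  moreover have "simplex_to_sphere q y 0 = (D - a\<^sup>2) / (D + a\<^sup>2)" "sphere_base 0 = 1"
    unfolding simplex_to_sphere_eq sphere_base_def by simp_all
  ultimately have "(D - a\<^sup>2) / (D + a\<^sup>2) = 1" by (simp only:)
  then show "Min (y ` {..q}) = 0" using den_pos unfolding a_def[symmetric] by (simp add: field_simps)
next
  assume "Min (y ` {..q}) = 0"
  then show "simplex_to_sphere q y = sphere_base"
    using den_pos unfolding simplex_to_sphere_eq sphere_base_def a_def[symmetric] by auto
qed

text \<open>
  The point of the simplex is recovered from the stereographic coordinates \<open>w\<close>: since \<open>y i = y 0 + a * w i\<close>
  and \<open>a\<close> is the least of these values, \<open>y i = a * (1 + w i - Min w)\<close>, and the sum of all \<open>y i\<close> determines \<open>a\<close>.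
\<close>

lemma simplex_from_sphere:
  assumes "Min (y ` {..q}) \<noteq> 0"
  defines "w \<equiv> (\<lambda>i. if i = 0 then 0 else simplex_to_sphere q y i / (1 - simplex_to_sphere q y 0))"
  shows "i \<le> q \<Longrightarrow> y i = (1 + w i - Min (w ` {..q})) / (\<Sum>j\<le>q. 1 + w j - Min (w ` {..q}))"
proof -
  have a: "a > 0" using assms(1) a_nonneg unfolding a_def[symmetric] by simp
  have "1 - simplex_to_sphere q y 0 = 2 * a\<^sup>2 / (D + a\<^sup>2)"
    unfolding simplex_to_sphere_eq using den_pos by (simp add: field_simps)
  then have w: "w i = (y i - y 0) / a" if "i \<le> q" for i
    using that den_pos a unfolding w_def simplex_to_sphere_eq by (simp add: power2_eq_square)
  have "Min (w ` {..q}) = (a - y 0) / a"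
  proof (rule Min_eqI)
    show "(a - y 0) / a \<le> v" if "v \<in> w ` {..q}" for v
      using that a_le a by (auto simp: w divide_right_mono)
    have "a \<in> y ` {..q}" unfolding a_def by (intro Min_in) auto
    then show "(a - y 0) / a \<in> w ` {..q}" using w by (auto simp: image_iff)
  qed simp
  then have eq: "1 + w j - Min (w ` {..q}) = y j / a" if "j \<le> q" for j
    using w[OF that] a by (simp add: field_simps)
  have "(\<Sum>j\<le>q. 1 + w j - Min (w ` {..q})) = (\<Sum>j\<le>q. y j / a)"
    by (rule sum.cong) (auto simp: eq)
  also have "\<dots> = 1 / a" using y_sum by (simp flip: sum_divide_distrib)
  finally show "i \<le> q \<Longrightarrow> y i = (1 + w i - Min (w ` {..q})) / (\<Sum>j\<le>q. 1 + w j - Min (w ` {..q}))"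
    using a by (simp add: eq)
qed

end

text \<open>
  The formula of \<open>simplex_from_sphere\<close> provides the preimage.
\<close>

lemma simplex_to_sphere_surj:
  assumes z: "z \<in> sphere_set q" "z \<noteq> sphere_base"
  obtains y where "\<And>i. i \<le> q \<Longrightarrow> 0 \<le> y i" "(\<Sum>i\<le>q. y i) = 1" "simplex_to_sphere q y = z"
proof -
  have z_sum: "(z 0)\<^sup>2 + (\<Sum>i\<in>{1..q}. (z i)\<^sup>2) = 1" and z_off: "\<And>i. i > q \<Longrightarrow> z i = 0"
    using z(1) unfolding sphere_set_def sum_split_0[of _ "q"] by auto
  have nn: "0 \<le> (\<Sum>i\<in>{1..q}. (z i)\<^sup>2)" by (intro sum_nonneg) simp
  then have "(z 0)\<^sup>2 \<le> 1" using z_sum by linarith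
  then have "z 0 \<le> 1" by (simp add: abs_square_le_1)
  moreover have "z 0 \<noteq> 1"
  proof
    assume 1: "z 0 = 1"
    then have "(\<Sum>i\<in>{1..q}. (z i)\<^sup>2) = 0" using z_sum by simp
    then have "\<forall>i\<in>{1..q}. z i = 0" by (subst (asm) sum_nonneg_eq_0_iff) auto
    then have "z i = sphere_base i" for i
      using 1 z_off[of i] by (cases "i = 0"; cases "i \<le> q") (auto simp: sphere_base_def)
    with z(2) show False by blast
  qed
  ultimately have z0: "z 0 < 1" by simp
  define w where "w i = (if i = 0 then 0 else z i / (1 - z 0))" for i
  define \<mu> where "\<mu> = Min (w ` {..q})"
  define a where "a = 1 / (\<Sum>j\<le>q. 1 + w j - \<mu>)"
  define y where "y i = a * (1 + w i - \<mu>)" for i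
  have \<mu>_le: "\<mu> \<le> w i" if "i \<le> q" for i using that unfolding \<mu>_def by simp
  have "(\<Sum>j\<le>q. 1 + w j - \<mu>) \<ge> (\<Sum>j\<le>q. 1)" by (rule sum_mono) (use \<mu>_le in auto)
  then have S: "(\<Sum>j\<le>q. 1 + w j - \<mu>) > 0" by simp
  then have a: "a > 0" unfolding a_def by simp
  have y_nonneg: "0 \<le> y i" if "i \<le> q" for i
    using \<mu>_le[OF that] a by (simp add: y_def)
  have y_sum: "(\<Sum>i\<le>q. y i) = 1"
    unfolding y_def sum_distrib_left[symmetric] using S by (simp add: a_def)
  have Min_y: "Min (y ` {..q}) = a"
  proof (rule Min_eqI)
    show "a \<le> v" if "v \<in> y ` {..q}" for v
      using that \<mu>_le a by (auto simp: y_def)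
    have "\<mu> \<in> w ` {..q}" unfolding \<mu>_def by (intro Min_in) auto
    then show "a \<in> y ` {..q}" by (auto simp: y_def image_iff)
  qed simp
  have diff: "y i - y 0 = a * w i" for i by (simp add: y_def w_def algebra_simps)
  have "(\<Sum>i\<le>q. (y i - y 0)\<^sup>2) = a\<^sup>2 * (\<Sum>i\<in>{1..q}. (z i)\<^sup>2) / (1 - z 0)\<^sup>2"
  proof -
    have "(\<Sum>i\<le>q. (y i - y 0)\<^sup>2) = (\<Sum>i\<in>{1..q}. (a * w i)\<^sup>2)"
      unfolding sum_split_0[of _ q] diff by (simp add: w_def)
    also have "\<dots> = (\<Sum>i\<in>{1..q}. a\<^sup>2 * (z i)\<^sup>2 / (1 - z 0)\<^sup>2)"
      by (rule sum.cong) (auto simp: w_def power_mult_distrib power_divide)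
    finally show ?thesis by (simp add: sum_distrib_left sum_divide_distrib)
  qed
  also have "(\<Sum>i\<in>{1..q}. (z i)\<^sup>2) = (1 - z 0) * (1 + z 0)"
    using z_sum by (simp add: power2_eq_square algebra_simps)
  also have "a\<^sup>2 * ((1 - z 0) * (1 + z 0)) / (1 - z 0)\<^sup>2 = a\<^sup>2 * (1 + z 0) / (1 - z 0)"
    using z0 by (simp add: power2_eq_square)
  finally have D: "(\<Sum>i\<le>q. (y i - y 0)\<^sup>2) = a\<^sup>2 * (1 + z 0) / (1 - z 0)" .
  have plus: "a\<^sup>2 * (1 + z 0) / (1 - z 0) + a\<^sup>2 = 2 * a\<^sup>2 / (1 - z 0)"
    and minus: "a\<^sup>2 * (1 + z 0) / (1 - z 0) - a\<^sup>2 = 2 * a\<^sup>2 * z 0 / (1 - z 0)"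
    using z0 by (simp_all add: field_simps)
  have "simplex_to_sphere q y i = z i" for i
    unfolding simplex_to_sphere_def Let_def Min_y D plus minus
    using z0 a z_off[of i] by (auto simp: diff w_def power2_eq_square)
  then show thesis using y_nonneg y_sum that by blast
qed

lemma simplex_to_sphere_inj:
  assumes "\<And>i. i \<le> q \<Longrightarrow> 0 \<le> y i" "(\<Sum>i\<le>q. y i) = 1"
    and "\<And>i. i \<le> q \<Longrightarrow> 0 \<le> y' i" "(\<Sum>i\<le>q. y' i) = 1"
    and "simplex_to_sphere q y = simplex_to_sphere q y'" "simplex_to_sphere q y \<noteq> sphere_base"
    and "i \<le> q"
  shows "y i = y' i"
proof -
  have nz: "Min (y ` {..q}) \<noteq> 0" "Min (y' ` {..q}) \<noteq> 0"
    using iffD2[OF simplex_to_sphere_eq_base[OF assms(1,2)]] iffD2[OF simplex_to_sphere_eq_base[OF assms(3,4)]]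
      assms(6) assms(6)[unfolded assms(5)] by blast+
  show ?thesis
    using simplex_from_sphere[OF assms(1,2) nz(1) assms(7)]
      simplex_from_sphere[OF assms(3,4) nz(2) assms(7), folded assms(5)] by (rule trans[OF _ sym])
qed

lemma continuous_on_simplex_to_sphere:
  assumes "continuous_on S f"
    and "\<And>x i. x \<in> S \<Longrightarrow> i \<le> q \<Longrightarrow> 0 \<le> f x i" and "\<And>x. x \<in> S \<Longrightarrow> (\<Sum>i\<le>q. f x i) = 1"
  shows "continuous_on S (\<lambda>x. simplex_to_sphere q (f x))"
proof (rule continuous_on_coordinatewise_then_product)
  fix i
  have coord: "continuous_on S (\<lambda>x. f x j)" for j
    by (rule continuous_on_product_then_coordinatewise[OF assms(1)])
  have Min: "continuous_on S (\<lambda>x. Min (f x ` {..q}))"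
    by (rule continuous_on_Min_image) (use assms(1) in auto)
  have den: "(\<Sum>i\<le>q. (f x i - f x 0)\<^sup>2) + (Min (f x ` {..q}))\<^sup>2 \<noteq> 0" if "x \<in> S" for x
    using simplex_to_sphere_denominator[of q "f x"] assms(2,3) that by simp
  show "continuous_on S (\<lambda>x. simplex_to_sphere q (f x) i)"
    unfolding simplex_to_sphere_def Let_def
    by (cases "i = 0"; cases "i \<le> q")
      (simp_all add: den coord Min continuous_on_divide continuous_on_add continuous_on_diff continuous_on_power
        continuous_on_sum continuous_on_mult)
qed

lemma wedge_of_spheres_eq:
  "wedge_of_spheres p q = wedge {..<p} (\<lambda>_. top_of_set (sphere_set q)) (\<lambda>_. sphere_base)"
  by (simp add: wedge_of_spheres_def nsphere_eq sphere_base_def)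

lemma openin_closed_iff:
  assumes "closed S"
  shows "openin (top_of_set S) {x \<in> S. P x} \<longleftrightarrow> closed {x \<in> S. \<not> P x}"
proof -
  have "openin (top_of_set S) {x \<in> S. P x} \<longleftrightarrow> closedin (top_of_set S) (S - {x \<in> S. P x})"
    by (subst openin_closedin_eq) auto
  also have "S - {x \<in> S. P x} = {x \<in> S. \<not> P x}" by auto
  also have "closedin (top_of_set S) \<dots> \<longleftrightarrow> closed {x \<in> S. \<not> P x}"
    unfolding closedin_closed_eq[OF assms] by auto
  finally show ?thesis .
qed

context attached_facets
begin

text \<open>
  The realization is mapped onto the wedge by \<open>g\<close>, which sends the subcomplex to the base point and the
  interior of each facet to the corresponding sphere by \<^const>\<open>simplex_to_sphere\<close>. It identifies no points
  except those of the subcomplex. It is a quotient map because the simplices are compact and the sphere is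
  a Hausdorff space, so that \<open>homotopy_equivalent_quotient\<close> applies to the deformation from \<open>squeeze\<close>.
\<close>

lemma attach_facets_wedge:
  assumes contr: "contractible (realization (K - C))" and ne: "realization (K - C) \<noteq> {}"
  shows "geometric_realization K homotopy_equivalent_space wedge_of_spheres (card C) q"
proof -
  let ?R = "realization K" and ?L = "realization (K - C)" and ?S = "sphere_set q"
  let ?W = "wedge {..<card C} (\<lambda>_. top_of_set ?S) (\<lambda>_. sphere_base)"
  let ?incl = "wedge_incl (\<lambda>_. sphere_base)"
  have "\<forall>\<sigma>\<in>C. \<exists>f. bij_betw f {..q} \<sigma>"
    using card_facet finite_facet by (auto intro!: finite_same_card_bij)
  then obtain e where e: "\<And>\<sigma>. \<sigma> \<in> C \<Longrightarrow> bij_betw (e \<sigma>) {..q} \<sigma>" by metis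
  obtain ix where ix: "bij_betw ix C {..<card C}"
    using finite_same_card_bij[OF finite_C, of "{..<card C}"] by auto
  define \<kappa> where "\<kappa> \<sigma> x = simplex_to_sphere q (\<lambda>i. x (e \<sigma> i))" for \<sigma> and x :: "'v \<Rightarrow> real"
  define g where "g x = (if {v. x v \<noteq> 0} \<in> C then Some (ix {v. x v \<noteq> 0}, \<kappa> {v. x v \<noteq> 0} x) else None)"
    for x :: "'v \<Rightarrow> real"
  have LR: "?L \<subseteq> ?R" by (rule realization_subset) auto
  have \<Delta>R: "realization (Pow \<sigma>) \<subseteq> ?R" if "\<sigma> \<in> C" for \<sigma>
    using that C_subset finite_complex_down[OF complex] by (intro realization_subset) auto
  have coords: "\<And>i. i \<le> q \<Longrightarrow> 0 \<le> x (e \<sigma> i)" "(\<Sum>i\<le>q. x (e \<sigma> i)) = 1"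
      "Min ((\<lambda>i. x (e \<sigma> i)) ` {..q}) = low \<sigma> x"
    if "\<sigma> \<in> C" "x \<in> realization (Pow \<sigma>)" for \<sigma> x
  proof -
    show "0 \<le> x (e \<sigma> i)" for i using that(2) by (rule realization_nonneg)
    have "(\<Sum>i\<le>q. x (e \<sigma> i)) = sum x \<sigma>" by (rule sum.reindex_bij_betw[OF e[OF that(1)]])
    then show "(\<Sum>i\<le>q. x (e \<sigma> i)) = 1"
      using that by (simp add: realization_Pow finite_facet)
    have "(\<lambda>i. x (e \<sigma> i)) ` {..q} = x ` \<sigma>"
      using bij_betw_imp_surj_on[OF e[OF that(1)]] by force
    then show "Min ((\<lambda>i. x (e \<sigma> i)) ` {..q}) = low \<sigma> x" by (simp add: low_def)
  qed
  have \<kappa>_in: "\<kappa> \<sigma> x \<in> ?S" if "\<sigma> \<in> C" "x \<in> realization (Pow \<sigma>)" for \<sigma> x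
    unfolding \<kappa>_def by (rule simplex_to_sphere_in) (use coords[OF that] in auto)
  have \<kappa>_base: "\<kappa> \<sigma> x = sphere_base \<longleftrightarrow> {v. x v \<noteq> 0} \<noteq> \<sigma>" if "\<sigma> \<in> C" "x \<in> realization (Pow \<sigma>)" for \<sigma> x
  proof -
    have "\<kappa> \<sigma> x = sphere_base \<longleftrightarrow> low \<sigma> x = 0"
      unfolding \<kappa>_def coords(3)[OF that, symmetric]
      by (rule simplex_to_sphere_eq_base) (use coords[OF that] in auto)
    then show ?thesis using low_eq_0_iff(1)[OF that(1)] \<Delta>R that by auto
  qed
  have \<kappa>_cont: "continuous_on (realization (Pow \<sigma>)) (\<kappa> \<sigma>)" if "\<sigma> \<in> C" for \<sigma>
    unfolding \<kappa>_def
    by (rule continuous_on_simplex_to_sphere)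
      (use coords[OF that] in \<open>auto intro!: continuous_on_coordinatewise_then_product continuous_on_coordinate\<close>)
  have g_L: "g x = None" if "x \<in> ?L" for x using realization_support[OF that] by (simp add: g_def)
  have g_None: "x \<in> ?L" if "x \<in> ?R" "g x = None" for x
    using that by (auto simp: g_def realization_def split: if_splits)
  have proper: "{v. x v \<noteq> 0} \<notin> C" if "\<sigma> \<in> C" "x \<in> realization (Pow \<sigma>)" "{v. x v \<noteq> 0} \<noteq> \<sigma>" for \<sigma> x
    using facet[of "{v. x v \<noteq> 0}" \<sigma>] that realization_support[OF that(2)] C_subset by auto
  have g_facet: "g x = ?incl (ix \<sigma>) (\<kappa> \<sigma> x)" if "\<sigma> \<in> C" "x \<in> realization (Pow \<sigma>)" for \<sigma> x
    using \<kappa>_base[OF that] proper[OF that] that(1) by (auto simp: g_def wedge_incl_def)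
  have \<kappa>_surj: "\<exists>x\<in>realization (Pow \<sigma>). \<kappa> \<sigma> x = z" if \<sigma>z: "\<sigma> \<in> C" "z \<in> ?S" "z \<noteq> sphere_base" for \<sigma> z
  proof -
    obtain y where y: "\<And>i. i \<le> q \<Longrightarrow> 0 \<le> y i" "(\<Sum>i\<le>q. y i) = 1" "simplex_to_sphere q y = z"
      using simplex_to_sphere_surj[OF \<sigma>z(2,3)] by blast
    define x where "x v = (if v \<in> \<sigma> then y (the_inv_into {..q} (e \<sigma>) v) else 0)" for v
    have inj: "inj_on (e \<sigma>) {..q}" and im: "e \<sigma> ` {..q} = \<sigma>"
      using e[OF \<sigma>z(1)] by (auto simp: bij_betw_def)
    have xe: "x (e \<sigma> i) = y i" if "i \<le> q" for i
      using that inj im by (auto simp: x_def the_inv_into_f_f)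
    have "0 \<le> x v" for v
      using the_inv_into_into[OF inj, of v "{..q}"] im y(1) by (auto simp: x_def)
    moreover have "sum x \<sigma> = 1"
    proof -
      have "sum x \<sigma> = (\<Sum>i\<le>q. x (e \<sigma> i))" by (rule sum.reindex_bij_betw[OF e[OF \<sigma>z(1)], symmetric])
      also have "\<dots> = (\<Sum>i\<le>q. y i)" by (rule sum.cong) (auto simp: xe)
      finally show ?thesis using y(2) by simp
    qed
    ultimately have "x \<in> realization (Pow \<sigma>)"
      using \<sigma>z(1) finite_facet by (simp add: realization_Pow x_def)
    moreover have "\<kappa> \<sigma> x = z"
    proof -
      have "(\<lambda>i. x (e \<sigma> i)) ` {..q} = y ` {..q}" by (rule image_cong) (auto simp: xe)
      moreover have "(\<Sum>i\<le>q. (x (e \<sigma> i) - x (e \<sigma> 0))\<^sup>2) = (\<Sum>i\<le>q. (y i - y 0)\<^sup>2)"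
        by (rule sum.cong) (auto simp: xe)
      ultimately have "simplex_to_sphere q (\<lambda>i. x (e \<sigma> i)) = simplex_to_sphere q y"
        unfolding simplex_to_sphere_def Let_def by (auto simp: xe fun_eq_iff)
      then show ?thesis using y(3) by (simp add: \<kappa>_def)
    qed
    ultimately show ?thesis by blast
  qed
  have g_inj: "x = y \<or> x \<in> ?L \<and> y \<in> ?L" if x: "x \<in> ?R" and y: "y \<in> ?R" and eq: "g x = g y" for x y
  proof (cases "g x")
    case None
    then show ?thesis using that g_None by simp
  next
    case (Some a)
    define \<sigma> where "\<sigma> = {v. x v \<noteq> 0}"
    have \<sigma>C: "\<sigma> \<in> C" and "{v. y v \<noteq> 0} \<in> C" "ix \<sigma> = ix {v. y v \<noteq> 0}" and \<kappa>_eq: "\<kappa> \<sigma> x = \<kappa> {v. y v \<noteq> 0} y"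
      using Some eq by (auto simp: g_def \<sigma>_def split: if_splits)
    then have supp: "{v. y v \<noteq> 0} = \<sigma>" using ix by (metis bij_betw_imp_inj_on inj_onD)
    have mem: "x \<in> realization (Pow \<sigma>)" "y \<in> realization (Pow \<sigma>)"
      using x y supp by (auto simp: realization_def \<sigma>_def)
    have "\<kappa> \<sigma> x \<noteq> sphere_base" using \<kappa>_base[OF \<sigma>C mem(1)] \<sigma>_def by simp
    then have "x (e \<sigma> i) = y (e \<sigma> i)" if "i \<le> q" for i
      by (intro simplex_to_sphere_inj[of q "\<lambda>i. x (e \<sigma> i)" "\<lambda>i. y (e \<sigma> i)"] coords[OF \<sigma>C mem(1)] coords[OF \<sigma>C mem(2)])
        (use that \<kappa>_eq in \<open>simp_all add: \<kappa>_def supp\<close>)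
    then have "x v = y v" if "v \<in> \<sigma>" for v
      using that bij_betw_imp_surj_on[OF e[OF \<sigma>C]] by (metis atMost_iff imageE)
    moreover have "x v = 0" "y v = 0" if "v \<notin> \<sigma>" for v using that supp \<sigma>_def by auto
    ultimately show ?thesis by (metis ext)
  qed
  have topspace_W: "topspace ?W = insert None (\<Union>\<sigma>\<in>C. ?incl (ix \<sigma>) ` ?S)"
    unfolding topspace_wedge bij_betw_imp_surj_on[OF ix, symmetric] by simp
  have cover: "?R = ?L \<union> (\<Union>\<sigma>\<in>C. realization (Pow \<sigma>))"
  proof
    show "?R \<subseteq> ?L \<union> (\<Union>\<sigma>\<in>C. realization (Pow \<sigma>))"
    proof
      fix x assume "x \<in> ?R"
      then show "x \<in> ?L \<union> (\<Union>\<sigma>\<in>C. realization (Pow \<sigma>))"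
        by (cases "{v. x v \<noteq> 0} \<in> C") (auto simp: realization_def)
    qed
  qed (use \<Delta>R LR in blast)
  have quot: "quotient_map (top_of_set ?R) ?W g"
  proof -
    obtain x0 where "x0 \<in> ?L" using ne by blast
    then have None_in: "None \<in> g ` ?R" using g_L[of x0] LR by (metis image_eqI subsetD)
    have "g ` ?R = topspace ?W"
    proof
      show "g ` ?R \<subseteq> topspace ?W"
      proof
        fix y assume "y \<in> g ` ?R"
        then obtain x where x: "y = g x" "x \<in> ?L \<union> (\<Union>\<sigma>\<in>C. realization (Pow \<sigma>))"
          using cover by blast
        show "y \<in> topspace ?W"
        proof (cases "x \<in> ?L")
          case True
          then show ?thesis unfolding topspace_W x(1) using g_L by simp
        next
          case False
          then obtain \<sigma> where \<sigma>: "\<sigma> \<in> C" "x \<in> realization (Pow \<sigma>)" using x(2) by blast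
          then have "y \<in> ?incl (ix \<sigma>) ` ?S" unfolding x(1) using g_facet \<kappa>_in by simp
          then show ?thesis unfolding topspace_W using \<sigma>(1) by blast
        qed
      qed
      have "?incl (ix \<sigma>) z \<in> g ` ?R" if \<sigma>z: "\<sigma> \<in> C" "z \<in> ?S" for \<sigma> z
      proof (cases "z = sphere_base")
        case True
        then show ?thesis using None_in by (simp add: wedge_incl_def)
      next
        case False
        then obtain x where "x \<in> realization (Pow \<sigma>)" "\<kappa> \<sigma> x = z" using \<kappa>_surj \<sigma>z by blast
        then show ?thesis using g_facet[OF \<sigma>z(1)] \<Delta>R[OF \<sigma>z(1)] by (metis image_eqI subsetD)
      qed
      then show "topspace ?W \<subseteq> g ` ?R" unfolding topspace_W using None_in by blast
    qed
    moreover have "openin (top_of_set ?R) {x \<in> ?R. g x \<in> U} \<longleftrightarrow> openin ?W U" if U: "U \<subseteq> topspace ?W" for U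
    proof -
      let ?N = "{x \<in> ?R. g x \<notin> U}"
      let ?Z = "\<lambda>\<sigma>. {z \<in> ?S. ?incl (ix \<sigma>) z \<notin> U}"
      have "openin ?W U \<longleftrightarrow> (\<forall>\<sigma>\<in>C. openin (top_of_set ?S) {z \<in> ?S. ?incl (ix \<sigma>) z \<in> U})"
        using U unfolding openin_wedge topspace_wedge bij_betw_imp_surj_on[OF ix, symmetric] by simp
      also have "\<dots> \<longleftrightarrow> (\<forall>\<sigma>\<in>C. closed (?Z \<sigma>))"
        by (simp add: openin_closed_iff[OF closed_sphere_set])
      also have "\<dots> \<longleftrightarrow> closed ?N"
      proof
        assume Z: "\<forall>\<sigma>\<in>C. closed (?Z \<sigma>)"
        have "?N = (if None \<in> U then {} else ?L) \<union> (\<Union>\<sigma>\<in>C. realization (Pow \<sigma>) \<inter> \<kappa> \<sigma> -` ?Z \<sigma>)"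
        proof -
          have "g x \<notin> U \<longleftrightarrow> \<kappa> \<sigma> x \<in> ?Z \<sigma>" if "\<sigma> \<in> C" "x \<in> realization (Pow \<sigma>)" for \<sigma> x
            using g_facet[OF that] \<kappa>_in[OF that] by simp
          moreover have "g x \<notin> U \<longleftrightarrow> None \<notin> U" if "x \<in> ?L" for x
            using g_L[OF that] by simp
          ultimately show ?thesis unfolding cover by auto
        qed
        moreover have "closed \<dots>"
          using Z by (intro closed_Un closed_UN finite_C ballI continuous_closed_preimage \<kappa>_cont
              closed_realization_Pow finite_facet) (auto intro: closed_realization L_complex)
        ultimately show "closed ?N" by simp
      next
        assume N: "closed ?N"
        show "\<forall>\<sigma>\<in>C. closed (?Z \<sigma>)"
        proof
          fix \<sigma> assume \<sigma>: "\<sigma> \<in> C"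
          have "z \<in> \<kappa> \<sigma> ` (realization (Pow \<sigma>) \<inter> ?N)" if z: "z \<in> ?Z \<sigma>" "z \<noteq> sphere_base" for z
          proof -
            obtain x where "x \<in> realization (Pow \<sigma>)" "\<kappa> \<sigma> x = z" using \<kappa>_surj[OF \<sigma>] z by blast
            then show ?thesis using g_facet[OF \<sigma>] \<Delta>R[OF \<sigma>] z by auto
          qed
          moreover have "\<kappa> \<sigma> x \<in> ?Z \<sigma>" if "x \<in> realization (Pow \<sigma>) \<inter> ?N" for x
            using that g_facet[OF \<sigma>] \<kappa>_in[OF \<sigma>] by auto
          (* The base point is treated separately because it need not be in the image of the facet: for
             q = 0, the boundary of the facet is empty. *)
          moreover define B where "B = ?Z \<sigma> \<inter> {sphere_base}"
          ultimately have Z_eq: "?Z \<sigma> = \<kappa> \<sigma> ` (realization (Pow \<sigma>) \<inter> ?N) \<union> B" by auto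
          have "compact (\<kappa> \<sigma> ` (realization (Pow \<sigma>) \<inter> ?N))"
            using compact_realization_Pow[OF finite_facet[OF \<sigma>]] N
            by (intro compact_continuous_image continuous_on_subset[OF \<kappa>_cont[OF \<sigma>]]) (auto intro: compact_Int_closed)
          moreover have "finite B" unfolding B_def by simp
          ultimately show "closed (?Z \<sigma>)"
            unfolding Z_eq by (intro closed_Un compact_imp_closed[of "\<kappa> \<sigma> ` _"] finite_imp_closed)
        qed
      qed
      also have "\<dots> \<longleftrightarrow> openin (top_of_set ?R) {x \<in> ?R. g x \<in> U}"
        by (simp add: openin_closed_iff[OF closed_realization[OF complex]])
      finally show ?thesis by simp
    qed
    ultimately show ?thesis unfolding quotient_map_def by simp
  qed
  obtain E c where E: "homotopic_with (\<lambda>f. f ` ?L \<subseteq> ?L) (top_of_set ?R) (top_of_set ?R) id E"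
    "\<And>x. x \<in> ?L \<Longrightarrow> E x = c"
    by (rule squeeze[OF contr]) (rule that)
  have "top_of_set ?R homotopy_equivalent_space ?W"
  proof (rule homotopy_equivalent_quotient[OF quot E(1)])
    show "g (f x) = g (f y)"
      if f: "f ` ?L \<subseteq> ?L" and xy: "x \<in> topspace (top_of_set ?R)" "y \<in> topspace (top_of_set ?R)" "g x = g y" for f x y
    proof -
      have "x = y \<or> x \<in> ?L \<and> y \<in> ?L" by (rule g_inj) (use xy in simp_all)
      then show ?thesis
      proof
        assume "x \<in> ?L \<and> y \<in> ?L"
        then have "f x \<in> ?L" "f y \<in> ?L" using f by blast+
        then show ?thesis using g_L by simp
      qed simp
    qed
    show "E x = E y" if xy: "x \<in> topspace (top_of_set ?R)" "y \<in> topspace (top_of_set ?R)" "g x = g y" for x y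
    proof -
      have "x = y \<or> x \<in> ?L \<and> y \<in> ?L" by (rule g_inj) (use xy in simp_all)
      then show ?thesis using E(2) by metis
    qed
  qed
  then show ?thesis by (simp add: geometric_realization_eq wedge_of_spheres_eq)
qed

end

section \<open>Independent sets of a tree\<close>

definition tree_edges :: "('a list \<times> 'a list) set" where
  "tree_edges = {(u, v). \<exists>i. v = i # u \<or> u = i # v}"

definition tree_connected :: "'a list set \<Rightarrow> bool" where
  "tree_connected Q \<longleftrightarrow> (\<forall>u\<in>Q. \<forall>v\<in>Q. (u, v) \<in> rtrancl_on Q tree_edges)"

lemma sym_tree_edges: "sym tree_edges"
  by (auto simp: sym_def tree_edges_def)

lemma rtrancl_on_tree_sym: "(u, v) \<in> rtrancl_on Q tree_edges \<Longrightarrow> (v, u) \<in> rtrancl_on Q tree_edges"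
  using rtrancl_on_sym[OF sym_tree_edges] by (rule symD)

text \<open>
  Such a set contains with every node the path that leads from it up to \<open>x\<close>.
\<close>

lemma tree_connected_prefix_closed:
  assumes "x \<in> Q" and "\<And>u. u \<in> Q \<Longrightarrow> \<exists>v. u = v @ x" and "\<And>i v. i # v @ x \<in> Q \<Longrightarrow> v @ x \<in> Q"
  shows "tree_connected Q"
proof -
  have "(x, v @ x) \<in> rtrancl_on Q tree_edges" if "v @ x \<in> Q" for v
    using that
  proof (induction v)
    case Nil
    then show ?case by simp
  next
    case (Cons i v)
    then have "(x, v @ x) \<in> rtrancl_on Q tree_edges" using assms(3)[of i v] by simp
    moreover have "(v @ x, (i # v) @ x) \<in> tree_edges" by (simp add: tree_edges_def)
    ultimately show ?case using Cons.prems by (rule rtrancl_on_into_rtrancl_on)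
  qed
  then have *: "(x, u) \<in> rtrancl_on Q tree_edges" if "u \<in> Q" for u
    using assms(2)[OF that] that by auto
  show ?thesis
    unfolding tree_connected_def
  proof (intro ballI)
    fix u v assume "u \<in> Q" "v \<in> Q"
    show "(u, v) \<in> rtrancl_on Q tree_edges"
      using rtrancl_on_tree_sym[OF *[OF \<open>u \<in> Q\<close>]] *[OF \<open>v \<in> Q\<close>] by (rule rtrancl_on_trans)
  qed
qed

lemma tree_connected_confined:
  assumes "tree_connected Q" "u \<in> Q" "u \<in> B"
    and "\<And>p q. p \<in> Q \<Longrightarrow> p \<in> B \<Longrightarrow> q \<in> Q \<Longrightarrow> (p, q) \<in> tree_edges \<Longrightarrow> q \<in> B"
  shows "Q \<subseteq> B"
proof
  fix v assume "v \<in> Q"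
  with assms(1,2) have "(u, v) \<in> rtrancl_on Q tree_edges" unfolding tree_connected_def by simp
  then have "v \<in> Q \<and> v \<in> B"
  proof (induction rule: rtrancl_on_induct)
    case base
    then show ?case using assms(2,3) by simp
  next
    case (step y z)
    then show ?case using assms(4)[of y z] by simp
  qed
  then show "v \<in> B" by simp
qed

lemma reachable_induced_tree:
  assumes "I \<subseteq> pverts (perfect_tree m h)"
  shows "reachable (with_proj (perfect_tree m h) \<restriction> I) u v \<longleftrightarrow> (u, v) \<in> rtrancl_on I tree_edges"
proof -
  let ?G = "with_proj (perfect_tree m h) \<restriction> I"
  have ends: "arcs_ends ?G = tree_edges \<inter> I \<times> I"
    using assms
    by (auto simp: arcs_ends_def arc_to_ends_def perfect_tree_def Let_def tree_edges_def image_iff)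
  have "(u, v) \<in> rtrancl_on I (tree_edges \<inter> I \<times> I)" if "(u, v) \<in> rtrancl_on I tree_edges"
    using that
  proof (induction rule: rtrancl_on_induct)
    case base
    then show ?case by simp
  next
    case (step y z)
    then show ?case using rtrancl_on_into_rtrancl_on[of u y I "tree_edges \<inter> I \<times> I" z] by simp
  qed
  moreover have "(u, v) \<in> rtrancl_on I tree_edges" if "(u, v) \<in> rtrancl_on I (tree_edges \<inter> I \<times> I)"
    using that by (rule rtrancl_on_mono[rotated 2]) auto
  ultimately show ?thesis by (auto simp: reachable_def ends)
qed

text \<open>
  Components are the maximal connected sets, so bounding the components amounts to bounding all
  connected subsets. In this form it is obvious that independence is inherited by subsets.
\<close>

lemma independence_complex_perfect_tree:
  "independence_complex r (with_proj (perfect_tree m h)) =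
     {I. I \<subseteq> pverts (perfect_tree m h) \<and> (\<forall>Q\<subseteq>I. tree_connected Q \<longrightarrow> card Q \<le> r)}"
proof -
  have "r_independent r (with_proj (perfect_tree m h)) I \<longleftrightarrow> (\<forall>Q\<subseteq>I. tree_connected Q \<longrightarrow> card Q \<le> r)"
    if I: "I \<subseteq> pverts (perfect_tree m h)" "finite I" for I
  proof
    assume r: "r_independent r (with_proj (perfect_tree m h)) I"
    show "\<forall>Q\<subseteq>I. tree_connected Q \<longrightarrow> card Q \<le> r"
    proof (intro allI impI)
      fix Q assume Q: "Q \<subseteq> I" "tree_connected Q"
      show "card Q \<le> r"
      proof (cases "Q = {}")
        case False
        then obtain u where u: "u \<in> Q" by blast
        define C where "C = {v. (u, v) \<in> rtrancl_on I tree_edges}"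
        have "C \<in> pre_digraph.sccs_verts (with_proj (perfect_tree m h) \<restriction> I)"
          unfolding pre_digraph.sccs_verts_def reachable_induced_tree[OF I(1)]
        proof (intro CollectI conjI ballI allI impI)
          show "C \<noteq> {}" using u Q(1) unfolding C_def by blast
          show "(v, w) \<in> rtrancl_on I tree_edges" if "v \<in> C" "w \<in> C" for v w
            using that unfolding C_def mem_Collect_eq by (rule rtrancl_on_trans[OF rtrancl_on_tree_sym])
          show "(v, w) \<notin> rtrancl_on I tree_edges \<or> (w, v) \<notin> rtrancl_on I tree_edges"
            if "v \<in> C" "w \<notin> C" for v w
            using that rtrancl_on_trans[of u v I tree_edges w] unfolding C_def mem_Collect_eq by metis
        qed
        then have "finite C" "card C \<le> r" using r by (auto simp: r_independent_def)
        moreover have "Q \<subseteq> C"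
        proof
          fix v assume "v \<in> Q"
          then have "(u, v) \<in> rtrancl_on Q tree_edges" using Q(2) u by (simp add: tree_connected_def)
          then show "v \<in> C" using rtrancl_on_mono[OF order_refl Q(1)] by (simp add: C_def)
        qed
        ultimately show ?thesis using card_mono order_trans by blast
      qed simp
    qed
  next
    assume *: "\<forall>Q\<subseteq>I. tree_connected Q \<longrightarrow> card Q \<le> r"
    have "finite C \<and> card C \<le> r"
      if "C \<in> pre_digraph.sccs_verts (with_proj (perfect_tree m h) \<restriction> I)" for C
    proof -
      have C: "\<And>u v. u \<in> C \<Longrightarrow> v \<in> C \<Longrightarrow> (u, v) \<in> rtrancl_on I tree_edges"
        "\<And>u v. u \<in> C \<Longrightarrow> (u, v) \<in> rtrancl_on I tree_edges \<Longrightarrow> v \<in> C"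
      proof -
        have scc: "\<forall>u\<in>C. \<forall>v\<in>C. (u, v) \<in> rtrancl_on I tree_edges"
          "\<forall>u\<in>C. \<forall>v. v \<notin> C \<longrightarrow> (u, v) \<notin> rtrancl_on I tree_edges \<or> (v, u) \<notin> rtrancl_on I tree_edges"
          using that unfolding pre_digraph.sccs_verts_def reachable_induced_tree[OF I(1)] by simp_all
        show "(u, v) \<in> rtrancl_on I tree_edges" if "u \<in> C" "v \<in> C" for u v using scc(1) that by simp
        show "v \<in> C" if "u \<in> C" "(u, v) \<in> rtrancl_on I tree_edges" for u v
          using scc(2) that rtrancl_on_tree_sym[OF that(2)] by metis
      qed
      have "C \<subseteq> I"
      proof
        fix u assume "u \<in> C"
        then show "u \<in> I" using C(1)[of u u] in_rtrancl_on_in_F(1) by metis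
      qed
      have "tree_connected C"
        unfolding tree_connected_def
      proof (intro ballI)
        fix u v assume "u \<in> C" "v \<in> C"
        have "v \<in> C \<and> (u, v) \<in> rtrancl_on C tree_edges"
          using C(1)[OF \<open>u \<in> C\<close> \<open>v \<in> C\<close>]
        proof (induction rule: rtrancl_on_induct)
          case base
          then show ?case using \<open>u \<in> C\<close> by simp
        next
          case (step y z)
          have "z \<in> C"
            using C(2)[OF \<open>u \<in> C\<close>] rtrancl_on_into_rtrancl_on[OF step.hyps(1,2,4)] by simp
          then show ?case using step rtrancl_on_into_rtrancl_on[of u y C tree_edges z] by simp
        qed
        then show "(u, v) \<in> rtrancl_on C tree_edges" by simp
      qed
      then show ?thesis using * \<open>C \<subseteq> I\<close> finite_subset[OF \<open>C \<subseteq> I\<close> I(2)] by simp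
    qed
    then show "r_independent r (with_proj (perfect_tree m h)) I"
      using I(1) by (auto simp: r_independent_def)
  qed
  moreover have "finite I" if "I \<subseteq> pverts (perfect_tree m h)" for I
    using that finite_lists_length_le[of "{..<m}" h] finite_subset by (fastforce simp: pverts_perfect_tree)
  ultimately show ?thesis unfolding independence_complex_def by (auto simp: r_independent_def)
qed

section \<open>Levels and blocks\<close>

locale perfect_tree_levels =
  fixes m h t r s :: nat
  assumes m: "0 < m" and t: "0 < t" and s: "s < m ^ t" and r: "r = (\<Sum>i<t. m ^ i) + s"
begin

definition Nodes :: "nat list set" where "Nodes = {u. set u \<subseteq> {..<m} \<and> length u \<le> h}"

definition Indep :: "nat list set set" where
  "Indep = {I. I \<subseteq> Nodes \<and> (\<forall>Q\<subseteq>I. tree_connected Q \<longrightarrow> card Q \<le> r)}"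

definition level :: "nat list \<Rightarrow> nat" where "level u = (h - length u) mod (t + 2)"

definition Separators :: "nat list set" where "Separators = {u \<in> Nodes. level u = t + 1}"
definition Inner :: "nat list set" where "Inner = {u \<in> Nodes. 1 \<le> level u \<and> level u \<le> t}"

definition subtree :: "nat list \<Rightarrow> nat \<Rightarrow> nat list set" where
  "subtree x k = {v @ x | v. set v \<subseteq> {..<m} \<and> length v \<le> k}"

text \<open>
  The leaf of the block of \<open>x\<close> that is reached from \<open>x\<close> by always choosing the child \<open>0\<close>.
\<close>

definition leaf :: "nat list \<Rightarrow> nat list" where "leaf x = replicate (level x) 0 @ x"

lemma finite_Nodes: "finite Nodes"
  unfolding Nodes_def using finite_lists_length_le[of "{..<m}" h] by simp

lemma Indep_complex: "finite_complex Indep"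
proof -
  have "Indep \<subseteq> Pow Nodes" by (auto simp: Indep_def)
  then have "finite Indep" using finite_Nodes finite_subset by blast
  moreover have "finite \<sigma>" if "\<sigma> \<in> Indep" for \<sigma> using that finite_Nodes finite_subset by (auto simp: Indep_def)
  ultimately show ?thesis unfolding finite_complex_def Indep_def by auto
qed

lemma level_le: "level u \<le> h - length u"
  unfolding level_def by simp

text \<open>
  Descending in a block lowers the level by one for each step, until the level \<open>0\<close> is reached.
\<close>

lemma level_append:
  assumes "length v \<le> level x"
  shows "level (v @ x) = level x - length v"
proof -
  define a where "a = h - length x"
  have "a - length v = (t + 2) * (a div (t + 2)) + (a mod (t + 2) - length v)"
    using assms mult_div_mod_eq[of "t + 2" a] unfolding level_def a_def by linarith
  then have "(a - length v) mod (t + 2) = (a mod (t + 2) - length v) mod (t + 2)"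
    by (metis mod_mult_self4)
  also have "\<dots> = a mod (t + 2) - length v"
    using mod_less_divisor[of "t + 2" a] by (intro mod_less) linarith
  finally show ?thesis
    unfolding level_def a_def by (simp add: add.commute)
qed

lemma level_parent:
  assumes "length u < h"
  shows "level u = (if level (i # u) = t + 1 then 0 else level (i # u) + 1)"
proof -
  have "h - length u = Suc (h - length (i # u))" using assms by simp
  then show ?thesis unfolding level_def by (simp only: mod_Suc) simp
qed

lemma append_in_Nodes:
  assumes "x \<in> Nodes" "set v \<subseteq> {..<m}" "length v \<le> level x"
  shows "v @ x \<in> Nodes"
  using assms level_le[of x] by (auto simp: Nodes_def)

lemma card_subtree: "card (subtree x k) = (\<Sum>i\<le>k. m ^ i)" and finite_subtree: "finite (subtree x k)"
proof -
  have eq: "subtree x k = (\<lambda>v. v @ x) ` {v. set v \<subseteq> {..<m} \<and> length v \<le> k}"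
    by (auto simp: subtree_def)
  show "finite (subtree x k)" unfolding eq using finite_lists_length_le[of "{..<m}" k] by simp
  have "card (subtree x k) = card {v. set v \<subseteq> {..<m} \<and> length v \<le> k}"
    unfolding eq by (intro card_image) (auto simp: inj_on_def)
  then show "card (subtree x k) = (\<Sum>i\<le>k. m ^ i)"
    using card_lists_length_le[of "{..<m}" k] by simp
qed

lemma subtree_connected:
  assumes "x \<in> Q" "Q \<subseteq> subtree x k" and "\<And>i v. i # v @ x \<in> Q \<Longrightarrow> v @ x \<in> Q"
  shows "tree_connected Q"
  using assms by (intro tree_connected_prefix_closed) (auto simp: subtree_def)

lemma leaf_in: "x \<in> Nodes \<Longrightarrow> leaf x \<in> Nodes" "level (leaf x) = 0"
  unfolding leaf_def using append_in_Nodes[of x "replicate (level x) 0"] level_append[of "replicate (level x) 0" x] m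
  by (auto simp: set_replicate_conv_if split: if_splits)

lemma leaf_notin: "leaf x \<notin> Separators \<union> Inner"
  using leaf_in(2)[of x] by (auto simp: Separators_def Inner_def)

text \<open>
  The component of the new leaf cannot leave the part below \<open>c\<close> of the block of \<open>c\<close>: the parent of \<open>c\<close> is
  missing, and so are the separators under the block, as they are deeper than \<open>c\<close>. This part has height
  less than \<open>t\<close>, hence no more than \<open>r\<close> nodes.
\<close>

lemma insert_leaf_independent:
  assumes c: "c \<in> Nodes" "level c < t" and up: "\<And>i w. c = i # w \<Longrightarrow> w \<notin> I"
    and sep: "\<And>z. z \<in> I \<Longrightarrow> z \<in> Separators \<Longrightarrow> length z \<le> length c"
    and I: "I \<in> Indep"
  shows "insert (leaf c) I \<in> Indep"
proof -
  have "card Q \<le> r" if Q: "Q \<subseteq> insert (leaf c) I" "tree_connected Q" for Q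
  proof (cases "leaf c \<in> Q")
    case False
    then show ?thesis using Q I by (auto simp: Indep_def)
  next
    case True
    have leaf: "leaf c \<in> subtree c (level c)" using m by (auto simp: subtree_def leaf_def)
    have "Q \<subseteq> subtree c (level c)"
    proof (rule tree_connected_confined[OF Q(2) True leaf])
      fix p q assume p: "p \<in> Q" "p \<in> subtree c (level c)" and q: "q \<in> Q" "(p, q) \<in> tree_edges"
      obtain v where v: "p = v @ c" "set v \<subseteq> {..<m}" "length v \<le> level c"
        using p by (auto simp: subtree_def)
      have Nodes: "Q \<subseteq> Nodes" using Q I leaf_in(1)[OF c(1)] by (auto simp: Indep_def)
      consider i where "q = i # p" | i where "p = i # q" using q(2) by (auto simp: tree_edges_def)
      then show "q \<in> subtree c (level c)"
      proof cases
        case (1 i)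
        have "i < m" using q(1) Nodes 1 by (auto simp: Nodes_def)
        show ?thesis
        proof (cases "length v < level c")
          case True
          then have "q = (i # v) @ c" "set (i # v) \<subseteq> {..<m}" "length (i # v) \<le> level c"
            using 1 v \<open>i < m\<close> by auto
          then show ?thesis unfolding subtree_def by blast
        next
          case False
          then have "level p = 0" using v level_append by simp
          moreover have "length p < h" using q(1) Nodes 1 by (auto simp: Nodes_def)
          ultimately have "level q = t + 1" using level_parent[of p i] 1 by (auto split: if_splits)
          moreover have "q \<in> Nodes" using q Nodes by blast
          ultimately have "q \<in> Separators" "q \<noteq> leaf c" using leaf_in(2)[of c] by (auto simp: Separators_def)
          then have "length q \<le> length c" using sep q(1) Q by blast
          then show ?thesis using 1 v by simp
        qed
      next
        case (2 i)
        show ?thesis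
        proof (cases v)
          case Nil
          then have "c = i # q" using 2 v by simp
          then have "q = leaf c" using up q Q by blast
          then have "length q \<ge> length c" by (simp add: leaf_def)
          then show ?thesis using \<open>c = i # q\<close> by simp
        next
          case (Cons j v')
          then have "q = v' @ c" "set v' \<subseteq> {..<m}" "length v' \<le> level c" using 2 v by auto
          then show ?thesis unfolding subtree_def by blast
        qed
      qed
    qed
    then have "card Q \<le> (\<Sum>i\<le>level c. m ^ i)"
      using card_mono[OF finite_subtree] card_subtree by metis
    also have "\<dots> \<le> (\<Sum>i<t. m ^ i)" by (rule sum_mono2) (use c in auto)
    finally show ?thesis using r by simp
  qed
  then show ?thesis using I leaf_in(1)[OF c(1)] by (auto simp: Indep_def)
qed

text \<open>
  Since \<open>s < m ^ t\<close>, a subtree of height \<open>t\<close> has more than \<open>r\<close> nodes, and it is connected.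
\<close>

lemma subtree_Separators_dependent:
  assumes "y \<in> Separators" "subtree y t \<subseteq> I"
  shows "I \<notin> Indep"
proof
  assume "I \<in> Indep"
  moreover have "tree_connected (subtree y t)"
    by (rule subtree_connected[of y _ t]) (auto simp: subtree_def)
  ultimately have "card (subtree y t) \<le> r" using assms(2) by (auto simp: Indep_def)
  moreover have "card (subtree y t) = (\<Sum>i<t. m ^ i) + m ^ t"
    unfolding card_subtree by (simp flip: lessThan_Suc_atMost)
  ultimately show False using r s by simp
qed

lemma subtree_Separators_subset: "y \<in> Separators \<Longrightarrow> subtree y t \<subseteq> insert y Inner"
proof
  fix u assume y: "y \<in> Separators" and "u \<in> subtree y t"
  then obtain v where v: "u = v @ y" "set v \<subseteq> {..<m}" "length v \<le> t" by (auto simp: subtree_def)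
  then show "u \<in> insert y Inner"
    using y append_in_Nodes[of y v] level_append[of v y] by (cases v) (auto simp: Separators_def Inner_def)
qed

text \<open>
  Whether \<open>insert_leaf_independent\<close> applies depends on the trace only, and the leaf is not part of the trace.
  So all sets with the trace \<open>E\<close> form a cone.
\<close>

lemma erasable_fibre_toggle:
  assumes c: "c \<in> Nodes" "level c < t"
    and up: "\<And>i w. c = i # w \<Longrightarrow> w \<in> Inner - E"
    and sep: "\<And>z. z \<in> E \<Longrightarrow> z \<in> Separators \<Longrightarrow> length z \<le> length c"
  shows "erasable {I \<in> Indep. I \<inter> (Separators \<union> Inner) = E}"
proof (rule erasable_cone)
  show "finite {I \<in> Indep. I \<inter> (Separators \<union> Inner) = E}"
    using finite_complex_finite[OF Indep_complex] by simp
  show "finite I" if "I \<in> {I \<in> Indep. I \<inter> (Separators \<union> Inner) = E}" for I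
    using that finite_complex_face_finite[OF Indep_complex] by blast
  fix I assume I: "I \<in> {I \<in> Indep. I \<inter> (Separators \<union> Inner) = E}"
  have "insert (leaf c) I \<in> Indep"
    by (rule insert_leaf_independent[OF c]) (use I up sep in blast)+
  moreover have "I - {leaf c} \<in> Indep" using I finite_complex_down[OF Indep_complex] by blast
  ultimately show "insert (leaf c) I \<in> {I \<in> Indep. I \<inter> (Separators \<union> Inner) = E} \<and>
      I - {leaf c} \<in> {I \<in> Indep. I \<inter> (Separators \<union> Inner) = E}"
    using I leaf_notin[of c] by auto
qed

lemma erasable_fibre_below:
  assumes w: "w \<in> Inner - E" and sep: "\<And>z. z \<in> E \<Longrightarrow> z \<in> Separators \<Longrightarrow> length z \<le> length w"
  shows "erasable {I \<in> Indep. I \<inter> (Separators \<union> Inner) = E}"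
proof (rule erasable_fibre_toggle[of "0 # w"])
  have "0 # w \<in> Nodes" "level (0 # w) = level w - 1"
    using w m append_in_Nodes[of w "[0]"] level_append[of "[0]" w] by (auto simp: Inner_def)
  then show "0 # w \<in> Nodes" "level (0 # w) < t" using w by (auto simp: Inner_def)
qed (use w sep in \<open>auto intro: le_SucI\<close>)

text \<open>
  With a separator in \<open>E\<close>, the missing inner node has to be sought below a deepest one, because the toggled
  leaf must not touch another separator of \<open>E\<close>.
\<close>

lemma erasable_fibre:
  assumes E: "E \<subseteq> Separators \<union> Inner" and "E \<noteq> Inner \<or> h mod (t + 2) < t"
  shows "erasable {I \<in> Indep. I \<inter> (Separators \<union> Inner) = E}"
proof (cases "E \<inter> Separators = {}")
  case True
  show ?thesis
  proof (cases "h mod (t + 2) < t")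
    case top: True
    show ?thesis
      by (rule erasable_fibre_toggle[of "[]"]) (use top True in \<open>auto simp: Nodes_def level_def\<close>)
  next
    case False
    then obtain w where "w \<in> Inner - E" using E True assms(2) by blast
    then show ?thesis by (rule erasable_fibre_below) (use True in blast)
  qed
next
  case False
  have fin: "finite (E \<inter> Separators)" using finite_Nodes by (rule finite_subset[rotated]) (auto simp: Separators_def)
  then have "Max (length ` (E \<inter> Separators)) \<in> length ` (E \<inter> Separators)" using False by (intro Max_in) auto
  then obtain y where y: "y \<in> E" "y \<in> Separators" "length y = Max (length ` (E \<inter> Separators))" by auto
  have longest: "length z \<le> length y" if "z \<in> E" "z \<in> Separators" for z
    unfolding y(3) using that fin by (intro Max_ge) auto
  show ?thesis
  proof (cases "subtree y t \<subseteq> E")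
    case True
    then have "{I \<in> Indep. I \<inter> (Separators \<union> Inner) = E} = {}"
      using subtree_Separators_dependent[OF y(2)] by blast
    then show ?thesis by (simp only: erasable.empty)
  next
    case False
    then obtain w where w: "w \<in> subtree y t" "w \<notin> E" by blast
    have "length y \<le> length w" using w(1) by (auto simp: subtree_def)
    then have "length z \<le> length w" if "z \<in> E" "z \<in> Separators" for z
      using longest[OF that] by simp
    moreover have "w \<in> Inner - E" using w subtree_Separators_subset[OF y(2)] y(1) by blast
    ultimately show ?thesis by (intro erasable_fibre_below)
  qed
qed

lemma erasable_Indep:
  assumes "h mod (t + 2) < t"
  shows "erasable Indep"
proof (rule erasable_fibres)
  show "finite (Separators \<union> Inner)"
    using finite_Nodes by (rule finite_subset[rotated]) (auto simp: Separators_def Inner_def)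
qed (use erasable_fibre assms in blast)

end

section \<open>Critical simplices\<close>

context perfect_tree_levels
begin

text \<open>
  These are the roots of the blocks of full height.
\<close>

definition Roots :: "nat list set" where "Roots = {x \<in> Nodes. level x = t}"

definition leaves :: "nat list \<Rightarrow> nat list set" where
  "leaves x = {v @ x | v. set v \<subseteq> {..<m} \<and> length v = t}"

definition Critical :: "nat list set set" where
  "Critical = {I. I \<subseteq> Nodes \<and> I \<inter> (Separators \<union> Inner) = Inner \<and>
     (\<forall>x\<in>Roots. leaf x \<notin> I \<and> card (I \<inter> leaves x) = s)}"

lemma finite_Roots: "finite Roots"
  unfolding Roots_def using finite_Nodes by simp

lemma card_leaves: "card (leaves x) = m ^ t" and finite_leaves: "finite (leaves x)"
proof -
  have eq: "leaves x = (\<lambda>v. v @ x) ` {v. set v \<subseteq> {..<m} \<and> length v = t}"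
    by (auto simp: leaves_def)
  show "finite (leaves x)" unfolding eq using finite_lists_length_eq[of "{..<m}" t] by simp
  have "card (leaves x) = card {v. set v \<subseteq> {..<m} \<and> length v = t}"
    unfolding eq by (intro card_image) (auto simp: inj_on_def)
  then show "card (leaves x) = m ^ t" using card_lists_length_eq[of "{..<m}" t] by simp
qed

lemma subtree_eq_leaves: "subtree x t = subtree x (t - 1) \<union> leaves x" "subtree x (t - 1) \<inter> leaves x = {}"
proof -
  have "length v \<le> t \<longleftrightarrow> length v \<le> t - 1 \<or> length v = t" for v :: "nat list" using t by linarith
  then show "subtree x t = subtree x (t - 1) \<union> leaves x"
    unfolding subtree_def leaves_def by blast
  have "length u < t + length x" if "u \<in> subtree x (t - 1)" for u
    using that t by (auto simp: subtree_def)
  moreover have "length u = t + length x" if "u \<in> leaves x" for u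
    using that by (auto simp: leaves_def)
  ultimately show "subtree x (t - 1) \<inter> leaves x = {}" by fastforce
qed

lemma leaves_Nodes: "x \<in> Roots \<Longrightarrow> u \<in> leaves x \<Longrightarrow> u \<in> Nodes \<and> level u = 0"
  using append_in_Nodes level_append by (auto simp: Roots_def leaves_def)

lemma leaves_outside: "x \<in> Roots \<Longrightarrow> leaves x \<inter> (Separators \<union> Inner) = {}"
  using leaves_Nodes by (fastforce simp: Separators_def Inner_def)

lemma leaf_in_leaves: "x \<in> Roots \<Longrightarrow> leaf x \<in> leaves x"
  using m by (auto simp: Roots_def leaves_def leaf_def set_replicate_conv_if)

lemma Roots_Inner: "x \<in> Roots \<Longrightarrow> subtree x (t - 1) \<subseteq> Inner"
proof
  fix u assume x: "x \<in> Roots" and "u \<in> subtree x (t - 1)"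
  then obtain v where v: "u = v @ x" "set v \<subseteq> {..<m}" "length v \<le> t - 1" by (auto simp: subtree_def)
  moreover have "level u = t - length v" using x v level_append[of v x] by (simp add: Roots_def)
  ultimately show "u \<in> Inner" using x append_in_Nodes[of x v] t by (auto simp: Roots_def Inner_def)
qed

lemma root_unique:
  assumes "x \<in> Roots" "x' \<in> Roots" "u \<in> subtree x t" "u \<in> subtree x' t"
  shows "x = x'"
proof -
  obtain v where v: "u = v @ x" "length v \<le> t" using assms(3) by (auto simp: subtree_def)
  obtain v' where v': "u = v' @ x'" "length v' \<le> t" using assms(4) by (auto simp: subtree_def)
  then have "t - length v = t - length v'"
    using assms(1,2) v v' level_append[of v x] level_append[of v' x'] by (simp add: Roots_def)
  then have "length v = length v'" using v(2) v'(2) by simp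
  moreover have "v @ x = v' @ x'" using v(1) v'(1) by simp
  ultimately show ?thesis by simp
qed

lemma leaves_disjoint: "x \<in> Roots \<Longrightarrow> x' \<in> Roots \<Longrightarrow> x \<noteq> x' \<Longrightarrow> leaves x \<inter> leaves x' = {}"
  using root_unique subtree_eq_leaves(1) by blast

text \<open>
  A node of level at most \<open>t\<close> that were too close to the root of the tree to have an ancestor of level \<open>t\<close>
  would lie in a topmost block of height less than \<open>t\<close>.
\<close>

lemma root_exists:
  assumes top: "t \<le> h mod (t + 2)" and u: "u \<in> Nodes" "level u \<le> t"
  shows "\<exists>x\<in>Roots. u \<in> subtree x t \<and> (level u = 0 \<longrightarrow> u \<in> leaves x)"
proof -
  have len: "t - level u \<le> length u"
  proof (rule ccontr)
    assume "\<not> t - level u \<le> length u"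
    then have less: "level u + length u < t" by simp
    have "h mod (t + 2) = ((h - length u) + length u) mod (t + 2)" using u(1) by (simp add: Nodes_def)
    also have "\<dots> = (level u + length u) mod (t + 2)" unfolding level_def by (simp only: mod_add_left_eq)
    also have "\<dots> = level u + length u" using less by simp
    finally show False using top less by simp
  qed
  define v where "v = take (t - level u) u"
  define x where "x = drop (t - level u) u"
  have uvx: "u = v @ x" and lv: "length v = t - level u" using len by (simp_all add: v_def x_def)
  have set: "set v \<subseteq> {..<m}" "set x \<subseteq> {..<m}" using u(1) uvx by (auto simp: Nodes_def)
  have x: "x \<in> Nodes" using u(1) uvx by (auto simp: Nodes_def)
  have "h - length x = (h - length u) + (t - level u)" using u(1) lv uvx by (auto simp: Nodes_def)
  then have "level x = (level u + (t - level u)) mod (t + 2)"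
    unfolding level_def by (simp only: mod_add_left_eq)
  then have "level x = t" using u(2) by simp
  then have "x \<in> Roots" using x by (simp add: Roots_def)
  moreover have "u \<in> subtree x t" using uvx set lv by (auto simp: subtree_def)
  moreover have "level u = 0 \<longrightarrow> u \<in> leaves x" using uvx set lv unfolding leaves_def by auto
  ultimately show ?thesis by (intro bexI[of _ x] conjI)
qed

lemma fibre_Inner_level:
  assumes "I \<subseteq> Nodes" "I \<inter> (Separators \<union> Inner) = Inner" "u \<in> I"
  shows "level u \<le> t"
proof -
  have "level u \<noteq> t + 1"
  proof
    assume "level u = t + 1"
    then have "u \<in> Inner" using assms by (auto simp: Separators_def)
    then show False using \<open>level u = t + 1\<close> by (simp add: Inner_def)
  qed
  moreover have "level u < t + 2" unfolding level_def by simp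
  ultimately show ?thesis by simp
qed

lemma card_block:
  assumes "x \<in> Roots" "I \<inter> (Separators \<union> Inner) = Inner"
  shows "card (I \<inter> subtree x t) = (\<Sum>i<t. m ^ i) + card (I \<inter> leaves x)"
proof -
  have "I \<inter> subtree x t = subtree x (t - 1) \<union> (I \<inter> leaves x)"
    using Roots_Inner[OF assms(1)] assms(2) subtree_eq_leaves(1)[of x] by blast
  moreover have "subtree x (t - 1) \<inter> (I \<inter> leaves x) = {}" using subtree_eq_leaves(2) by blast
  ultimately have "card (I \<inter> subtree x t) = card (subtree x (t - 1)) + card (I \<inter> leaves x)"
    by (simp add: card_Un_disjoint finite_subtree finite_leaves)
  also have "{..t - 1} = {..<t}" using t by auto
  then have "card (subtree x (t - 1)) = (\<Sum>i<t. m ^ i)" by (simp add: card_subtree)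
  finally show ?thesis .
qed

text \<open>
  In the absence of separators every connected set lies in a single block. The \<open>n\<close> inner nodes of the block
  are connected to each other and to all its leaves, so that just \<open>r - n = s\<close> leaves are affordable.
\<close>

lemma fibre_Inner_iff:
  assumes top: "t \<le> h mod (t + 2)" and I: "I \<subseteq> Nodes" "I \<inter> (Separators \<union> Inner) = Inner"
  shows "I \<in> Indep \<longleftrightarrow> (\<forall>x\<in>Roots. card (I \<inter> leaves x) \<le> s)"
proof
  assume Indep: "I \<in> Indep"
  show "\<forall>x\<in>Roots. card (I \<inter> leaves x) \<le> s"
  proof
    fix x assume x: "x \<in> Roots"
    have sub: "subtree x (t - 1) \<subseteq> I" using Roots_Inner[OF x] I(2) by blast
    have "tree_connected (I \<inter> subtree x t)"
    proof (rule subtree_connected)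
      show "x \<in> I \<inter> subtree x t" using sub by (auto simp: subtree_def)
      show "v @ x \<in> I \<inter> subtree x t" if "i # v @ x \<in> I \<inter> subtree x t" for i v
      proof -
        have "set v \<subseteq> {..<m} \<and> length v \<le> t - 1" using that by (auto simp: subtree_def)
        then have "v @ x \<in> subtree x (t - 1)" by (auto simp: subtree_def)
        then show ?thesis using sub subtree_eq_leaves(1) by blast
      qed
    qed (rule Int_lower2)
    then have "card (I \<inter> subtree x t) \<le> r" using Indep by (auto simp: Indep_def)
    then show "card (I \<inter> leaves x) \<le> s" using card_block[OF x I(2)] r by simp
  qed
next
  assume *: "\<forall>x\<in>Roots. card (I \<inter> leaves x) \<le> s"
  have "card Q \<le> r" if Q: "Q \<subseteq> I" "tree_connected Q" for Q
  proof (cases "Q = {}")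
    case False
    then obtain u where u: "u \<in> Q" by blast
    have le: "level p \<le> t" if "p \<in> Q" for p
      using fibre_Inner_level[OF I] that Q(1) by blast
    obtain x where x: "x \<in> Roots" "u \<in> subtree x t"
      using root_exists[OF top _ le[OF u]] u Q(1) I(1) by blast
    have "Q \<subseteq> subtree x t"
    proof (rule tree_connected_confined[OF Q(2) u x(2)])
      fix p q assume p: "p \<in> Q" "p \<in> subtree x t" and q: "q \<in> Q" "(p, q) \<in> tree_edges"
      obtain v where v: "p = v @ x" "set v \<subseteq> {..<m}" "length v \<le> t"
        using p by (auto simp: subtree_def)
      have lp: "level p = t - length v" using v x(1) level_append[of v x] by (simp add: Roots_def)
      have Nodes: "p \<in> Nodes" "q \<in> Nodes" using p q Q(1) I(1) by auto
      consider i where "q = i # p" | i where "p = i # q" using q(2) by (auto simp: tree_edges_def)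
      then show "q \<in> subtree x t"
      proof cases
        case (1 i)
        have len: "length p < h" "i < m" using Nodes(2) 1 by (auto simp: Nodes_def)
        have "length v \<noteq> t"
        proof
          assume "length v = t"
          then have "level q = t + 1" using level_parent[OF len(1), of i] lp 1 by (auto split: if_splits)
          then show False using le[OF q(1)] by simp
        qed
        then have "q = (i # v) @ x" "set (i # v) \<subseteq> {..<m}" "length (i # v) \<le> t"
          using 1 v len by auto
        then show ?thesis unfolding subtree_def by blast
      next
        case (2 i)
        show ?thesis
        proof (cases v)
          case Nil
          then have "level q = t + 1"
            using level_parent[of q i] 2 Nodes(1) lp by (auto simp: Nodes_def)
          then show ?thesis using le[OF q(1)] by simp
        next
          case (Cons j v')
          then have "q = v' @ x" "set v' \<subseteq> {..<m}" "length v' \<le> t" using 2 v by auto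
          then show ?thesis unfolding subtree_def by blast
        qed
      qed
    qed
    then have "card Q \<le> card (I \<inter> subtree x t)" using Q(1) finite_subtree by (intro card_mono) auto
    also have "\<dots> \<le> r" using card_block[OF x(1) I(2)] * x(1) r by simp
    finally show ?thesis .
  qed simp
  then show "I \<in> Indep" using I(1) by (auto simp: Indep_def)
qed

lemma Critical_subset_Indep: "t \<le> h mod (t + 2) \<Longrightarrow> Critical \<subseteq> Indep"
  using fibre_Inner_iff by (auto simp: Critical_def)

text \<open>
  No separator can be added, as all the inner nodes below it are present; and no leaf can be added, as every
  block already has \<open>s\<close> of them.
\<close>

lemma Critical_facet:
  assumes top: "t \<le> h mod (t + 2)" and \<sigma>: "\<sigma> \<in> Critical" and \<tau>: "\<tau> \<in> Indep" "\<sigma> \<subseteq> \<tau>"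
  shows "\<tau> = \<sigma>"
proof -
  have Inner: "Inner \<subseteq> \<tau>" using \<sigma> \<tau>(2) by (auto simp: Critical_def)
  have "\<tau> \<inter> Separators = {}"
  proof (rule ccontr)
    assume "\<tau> \<inter> Separators \<noteq> {}"
    then obtain y where "y \<in> \<tau>" "y \<in> Separators" by blast
    then show False using subtree_Separators_dependent subtree_Separators_subset Inner \<tau>(1) by blast
  qed
  then have fib: "\<tau> \<inter> (Separators \<union> Inner) = Inner" using Inner by blast
  have \<tau>Nodes: "\<tau> \<subseteq> Nodes" using \<tau>(1) by (auto simp: Indep_def)
  have eq: "\<sigma> \<inter> leaves x = \<tau> \<inter> leaves x" if x: "x \<in> Roots" for x
  proof (rule card_subset_eq)
    have "card (\<tau> \<inter> leaves x) \<le> s" using fibre_Inner_iff[OF top \<tau>Nodes fib] \<tau>(1) x by blast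
    moreover have "card (\<sigma> \<inter> leaves x) = s" using \<sigma> x by (auto simp: Critical_def)
    moreover have "card (\<sigma> \<inter> leaves x) \<le> card (\<tau> \<inter> leaves x)"
      using \<tau>(2) finite_leaves by (intro card_mono) auto
    ultimately show "card (\<sigma> \<inter> leaves x) = card (\<tau> \<inter> leaves x)" by simp
  qed (use \<tau>(2) finite_leaves in auto)
  have "u \<in> \<sigma>" if "u \<in> \<tau>" for u
  proof (cases "u \<in> Inner")
    case True
    then show ?thesis using \<sigma> by (auto simp: Critical_def)
  next
    case False
    have "u \<in> Nodes" "level u \<le> t" using fibre_Inner_level[OF \<tau>Nodes fib] \<tau>Nodes that by auto
    then have "level u = 0" using False by (simp add: Inner_def)
    then obtain x where "x \<in> Roots" "u \<in> leaves x"
      using root_exists[OF top \<open>u \<in> Nodes\<close> \<open>level u \<le> t\<close>] by blast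
    then show ?thesis using eq that by blast
  qed
  then show ?thesis using \<tau>(2) by blast
qed

lemma card_Critical_face:
  assumes top: "t \<le> h mod (t + 2)" and \<sigma>: "\<sigma> \<in> Critical"
  shows "card \<sigma> = r * card Roots"
proof -
  have fib: "\<sigma> \<inter> (Separators \<union> Inner) = Inner" and Nodes: "\<sigma> \<subseteq> Nodes" using \<sigma> by (auto simp: Critical_def)
  have "\<sigma> = (\<Union>x\<in>Roots. \<sigma> \<inter> subtree x t)"
  proof -
    have "\<exists>x\<in>Roots. u \<in> subtree x t" if "u \<in> \<sigma>" for u
    proof -
      have "u \<in> Nodes" using that Nodes by blast
      then show ?thesis using root_exists[OF top _ fibre_Inner_level[OF Nodes fib that]] by blast
    qed
    then show ?thesis by blast
  qed
  then have "card \<sigma> = card (\<Union>x\<in>Roots. \<sigma> \<inter> subtree x t)" by simp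
  also have "\<dots> = (\<Sum>x\<in>Roots. card (\<sigma> \<inter> subtree x t))"
    using root_unique by (intro card_UN_disjoint finite_Roots) (auto simp: finite_subtree)
  also have "\<dots> = (\<Sum>x\<in>Roots. r)"
    using \<sigma> by (intro sum.cong) (auto simp: card_block[OF _ fib] r Critical_def)
  finally show ?thesis by simp
qed

lemma card_Critical:
  assumes top: "t \<le> h mod (t + 2)"
  shows "card Critical = ((m ^ t - 1) choose s) ^ card Roots"
proof -
  define B where "B x = {A. A \<subseteq> leaves x - {leaf x} \<and> card A = s}" for x
  define f where "f \<sigma> = (\<lambda>x\<in>Roots. \<sigma> \<inter> leaves x)" for \<sigma> :: "nat list set"
  define g where "g F = Inner \<union> (\<Union>x\<in>Roots. F x)" for F :: "nat list \<Rightarrow> nat list set"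
  have g_leaves: "g F \<inter> leaves x = F x" if F: "F \<in> PiE Roots B" and x: "x \<in> Roots" for F x
  proof -
    have sub: "F y \<subseteq> leaves y" if "y \<in> Roots" for y using PiE_mem[OF F that] by (auto simp: B_def)
    have "F y \<inter> leaves x = {}" if "y \<in> Roots" "y \<noteq> x" for y
      using leaves_disjoint[OF that(1) x that(2)] sub[OF that(1)] by blast
    then show ?thesis using sub[OF x] leaves_outside[OF x] x unfolding g_def by blast
  qed
  have g_in: "g F \<in> Critical" if F: "F \<in> PiE Roots B" for F
  proof -
    have sub: "F y \<subseteq> leaves y - {leaf y}" "card (F y) = s" if "y \<in> Roots" for y
      using PiE_mem[OF F that] by (auto simp: B_def)
    have "g F \<subseteq> Nodes" unfolding g_def using sub(1) leaves_Nodes by (fastforce simp: Inner_def)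
    moreover have "g F \<inter> (Separators \<union> Inner) = Inner"
    proof -
      have "Inner \<inter> Separators = {}" by (auto simp: Inner_def Separators_def)
      moreover have "F y \<inter> (Separators \<union> Inner) = {}" if "y \<in> Roots" for y
        using sub(1)[OF that] leaves_outside[OF that] by blast
      ultimately show ?thesis unfolding g_def by blast
    qed
    moreover have "leaf x \<notin> g F" if x: "x \<in> Roots" for x
      using g_leaves[OF F x] leaf_in_leaves[OF x] sub(1)[OF x] by blast
    ultimately show ?thesis unfolding Critical_def using g_leaves[OF F] sub(2) by simp
  qed
  have f_in: "f \<sigma> \<in> PiE Roots B" if \<sigma>: "\<sigma> \<in> Critical" for \<sigma>
    using \<sigma> unfolding f_def B_def Critical_def by auto
  have gf: "g (f \<sigma>) = \<sigma>" if \<sigma>: "\<sigma> \<in> Critical" for \<sigma>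
  proof (rule Critical_facet[OF top _ _, symmetric])
    show "g (f \<sigma>) \<in> Critical" using g_in f_in \<sigma> by blast
    show "\<sigma> \<in> Indep" using Critical_subset_Indep[OF top] \<sigma> by blast
    show "g (f \<sigma>) \<subseteq> \<sigma>" using \<sigma> by (auto simp: g_def f_def Critical_def)
  qed
  have fg: "f (g F) = F" if F: "F \<in> PiE Roots B" for F
    by (rule PiE_ext[OF f_in[OF g_in[OF F]] F]) (simp add: f_def g_leaves[OF F])
  have "bij_betw f Critical (PiE Roots B)"
    by (rule bij_betw_byWitness[where f' = g]) (intro ballI gf fg image_subsetI f_in g_in, assumption)+
  then have "card Critical = card (PiE Roots B)" by (rule bij_betw_same_card)
  also have "\<dots> = (\<Prod>x\<in>Roots. card (B x))" by (rule card_PiE[OF finite_Roots])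
  also have "\<dots> = (\<Prod>x\<in>Roots. (m ^ t - 1) choose s)"
  proof (rule prod.cong[OF refl])
    fix x assume x: "x \<in> Roots"
    have "card (leaves x - {leaf x}) = m ^ t - 1"
      using leaf_in_leaves[OF x] finite_leaves card_leaves by simp
    then show "card (B x) = (m ^ t - 1) choose s"
      unfolding B_def using n_subsets[of "leaves x - {leaf x}" s] finite_leaves by simp
  qed
  finally show ?thesis by simp
qed

text \<open>
  Deciding all leaves but the fixed one of every block leaves two possibilities. Either some block has fewer
  than \<open>s\<close> of the decided leaves, and then its fixed leaf is free; or all blocks have \<open>s\<close> of them, and then no
  fixed leaf can be present and the set is critical.
\<close>

lemma erasable_fibre_Inner:
  assumes top: "t \<le> h mod (t + 2)"
  shows "erasable {I \<in> Indep - Critical. I \<inter> (Separators \<union> Inner) = Inner}" (is "erasable ?F")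
proof (rule erasable_fibres)
  let ?D = "\<Union>x\<in>Roots. leaves x - {leaf x}"
  show "finite ?D" using finite_Roots finite_leaves by simp
  fix E assume "E \<subseteq> ?D"
  let ?G = "{I \<in> ?F. I \<inter> ?D = E}"
  have trace: "I \<inter> (leaves x - {leaf x}) = E \<inter> (leaves x - {leaf x})" if "I \<inter> ?D = E" "x \<in> Roots" for I x
    using that by blast
  show "erasable ?G"
  proof (cases "\<exists>x\<in>Roots. card (E \<inter> (leaves x - {leaf x})) < s")
    case True
    then obtain x where x: "x \<in> Roots" "card (E \<inter> (leaves x - {leaf x})) < s" by blast
    have leaf_D: "leaf x \<notin> ?D"
      using leaf_in_leaves[OF x(1)] leaves_disjoint[OF x(1)] by blast
    have step: "J \<in> ?G" if I: "I \<in> ?G" and J: "J = insert (leaf x) I \<or> J = I - {leaf x}" for I J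
    proof -
      have JD: "J \<inter> ?D = E" using I J leaf_D by blast
      have JV: "J \<subseteq> Nodes" using I J leaf_in(1)[of x] x(1) by (auto simp: Indep_def Roots_def)
      have Jfib: "J \<inter> (Separators \<union> Inner) = Inner" using I J leaf_notin[of x] by blast
      have "card (J \<inter> leaves x') \<le> s" if x': "x' \<in> Roots" for x'
      proof (cases "x' = x")
        case True
        have "J \<inter> leaves x \<subseteq> insert (leaf x) (E \<inter> (leaves x - {leaf x}))"
          using trace[OF JD x(1)] by blast
        then have "card (J \<inter> leaves x) \<le> card (insert (leaf x) (E \<inter> (leaves x - {leaf x})))"
          using finite_leaves by (intro card_mono) auto
        also have "\<dots> \<le> Suc (card (E \<inter> (leaves x - {leaf x})))" by (rule card_insert_le_m1) auto
        finally show ?thesis using x(2) True by simp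
      next
        case False
        then have "J \<inter> leaves x' = I \<inter> leaves x'"
          using J leaf_in_leaves[OF x(1)] leaves_disjoint[OF x(1) x'] by blast
        moreover have "I \<in> Indep" "I \<subseteq> Nodes" "I \<inter> (Separators \<union> Inner) = Inner" using I by (auto simp: Indep_def)
        ultimately show ?thesis using fibre_Inner_iff[OF top] x' by metis
      qed
      then have "J \<in> Indep" using fibre_Inner_iff[OF top JV Jfib] by blast
      moreover have "J \<notin> Critical"
      proof
        assume C: "J \<in> Critical"
        then have "leaf x \<notin> J" "card (J \<inter> leaves x) = s" using x(1) by (auto simp: Critical_def)
        then have "J \<inter> leaves x = E \<inter> (leaves x - {leaf x})" using trace[OF JD x(1)] by blast
        then show False using \<open>card (J \<inter> leaves x) = s\<close> x(2) by simp
      qed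
      ultimately show ?thesis using Jfib JD by simp
    qed
    show ?thesis
    proof (rule erasable_cone)
      show "finite ?G" using finite_complex_finite[OF Indep_complex] by simp
      show "finite I" if "I \<in> ?G" for I using that finite_complex_face_finite[OF Indep_complex] by blast
      show "insert (leaf x) I \<in> ?G \<and> I - {leaf x} \<in> ?G" if "I \<in> ?G" for I
        using step[OF that] by blast
    qed
  next
    case False
    have "I \<in> Critical" if I: "I \<in> Indep" "I \<inter> (Separators \<union> Inner) = Inner" "I \<inter> ?D = E" for I
    proof -
      have Nodes: "I \<subseteq> Nodes" using I(1) by (auto simp: Indep_def)
      have "leaf x \<notin> I \<and> card (I \<inter> leaves x) = s" if x: "x \<in> Roots" for x
      proof -
        have "s \<le> card (I \<inter> (leaves x - {leaf x}))" using False x trace[OF I(3) x] by auto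
        also have "\<dots> \<le> card (I \<inter> leaves x)" using finite_leaves by (intro card_mono) auto
        finally have s_le: "s \<le> card (I \<inter> leaves x)" .
        have le_s: "card (I \<inter> leaves x) \<le> s" using fibre_Inner_iff[OF top Nodes I(2)] I(1) x by blast
        have "I \<inter> (leaves x - {leaf x}) = I \<inter> leaves x"
          using finite_leaves le_s \<open>s \<le> card (I \<inter> (leaves x - {leaf x}))\<close>
          by (intro card_seteq) auto
        then show ?thesis using s_le le_s leaf_in_leaves[OF x] by auto
      qed
      then show ?thesis using Nodes I(2) by (simp add: Critical_def)
    qed
    then have "?G = {}" by blast
    then show ?thesis by (simp only: erasable.empty)
  qed
qed

lemma erasable_Indep_minus_Critical:
  assumes top: "t \<le> h mod (t + 2)"
  shows "erasable (Indep - Critical)"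
proof (rule erasable_fibres)
  show "finite (Separators \<union> Inner)"
    using finite_Nodes by (rule finite_subset[rotated]) (auto simp: Separators_def Inner_def)
  fix E assume E: "E \<subseteq> Separators \<union> Inner"
  show "erasable {I \<in> Indep - Critical. I \<inter> (Separators \<union> Inner) = E}"
  proof (cases "E = Inner")
    case True
    then show ?thesis using erasable_fibre_Inner[OF top] by simp
  next
    case False
    then have "{I \<in> Indep - Critical. I \<inter> (Separators \<union> Inner) = E} = {I \<in> Indep. I \<inter> (Separators \<union> Inner) = E}"
      by (auto simp: Critical_def)
    then show ?thesis using erasable_fibre[OF E] False by simp
  qed
qed

lemma Roots_nonempty:
  assumes top: "t \<le> h mod (t + 2)"
  shows "Roots \<noteq> {}"
proof (cases "h mod (t + 2) = t")
  case True
  then have "[] \<in> Roots" by (simp add: Roots_def Nodes_def level_def)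
  then show ?thesis by blast
next
  case False
  moreover have "h mod (t + 2) < t + 2" by simp
  ultimately have *: "h mod (t + 2) = t + 1" using top by linarith
  then have "0 < h" by (metis mod_0 add_gr_0 zero_less_one less_numeral_extra(3) gr0I)
  then have "level [] = (if level [0] = t + 1 then 0 else level [0] + 1)" using level_parent[of "[]" 0] by simp
  then have "level [0] = t" using * by (simp add: level_def split: if_splits)
  then have "[0] \<in> Roots" using m \<open>0 < h\<close> by (simp add: Roots_def Nodes_def)
  then show ?thesis by blast
qed

lemma independence_complex_eq: "independence_complex r (with_proj (perfect_tree m h)) = Indep"
  unfolding independence_complex_perfect_tree Indep_def Nodes_def pverts_perfect_tree ..

lemma Indep_minus_Critical_nonempty:
  assumes top: "t \<le> h mod (t + 2)"
  shows "Indep - Critical \<noteq> {}"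
proof -
  obtain x where x: "x \<in> Roots" using Roots_nonempty[OF top] by blast
  then have "x \<in> Inner" using t by (simp add: Roots_def Inner_def)
  then have "{} \<notin> Critical" by (auto simp: Critical_def)
  moreover have "{} \<in> Indep" by (simp add: Indep_def)
  ultimately show ?thesis by blast
qed

theorem independence_complex_point:
  assumes "h mod (t + 2) < t"
  shows "geometric_realization (independence_complex r (with_proj (perfect_tree m h)))
    homotopy_equivalent_space discrete_topology {()}"
proof -
  have "{} \<in> Indep" by (simp add: Indep_def)
  then have "realization Indep \<noteq> {}" "contractible (realization Indep)"
    using erasable_imp_contractible[OF erasable_Indep[OF assms] Indep_complex] by auto
  then show ?thesis
    unfolding independence_complex_eq geometric_realization_eq by (intro contractible_nonempty_imp_point)
qed

theorem independence_complex_wedge: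
  assumes top: "t \<le> h mod (t + 2)"
  shows "geometric_realization (independence_complex r (with_proj (perfect_tree m h)))
    homotopy_equivalent_space
    wedge_of_spheres (((m ^ t - 1) choose s) ^ card Roots) (r * card Roots - 1)"
proof -
  have "1 \<le> (\<Sum>i<t. m ^ i)" using member_le_sum[of 0 "{..<t}" "\<lambda>i. m ^ i"] t by simp
  moreover have "0 < card Roots" using Roots_nonempty[OF top] finite_Roots by (simp add: card_gt_0_iff)
  ultimately have pos: "0 < r * card Roots" using r by simp
  interpret attached_facets Indep Critical "r * card Roots - 1"
    using Indep_complex Critical_subset_Indep[OF top] Critical_facet[OF top] card_Critical_face[OF top] pos
    by unfold_locales auto
  have "realization (Indep - Critical) \<noteq> {}" "contractible (realization (Indep - Critical))"
    using erasable_imp_contractible[OF erasable_Indep_minus_Critical[OF top] L_complex Indep_minus_Critical_nonempty[OF top]]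
    by auto
  then show ?thesis
    unfolding independence_complex_eq card_Critical[OF top, symmetric] by (intro attach_facets_wedge)
qed

text \<open>
  The map \<open>d\<close> enumerates the depths at which the roots of the full blocks are found.
\<close>

lemma card_Roots:
  assumes "inj_on d J" "d ` J = {l. l \<le> h \<and> (h - l) mod (t + 2) = t}"
  shows "card Roots = (\<Sum>j\<in>J. m ^ d j)"
proof -
  let ?N = "{l. l \<le> h \<and> (h - l) mod (t + 2) = t}"
  have "Roots = (\<Union>l\<in>?N. {u. set u \<subseteq> {..<m} \<and> length u = l})"
    by (auto simp: Roots_def Nodes_def level_def)
  then have "card Roots = (\<Sum>l\<in>?N. card {u. set u \<subseteq> {..<m} \<and> length u = l})"
    by (simp only:) (rule card_UN_disjoint; auto intro!: finite_lists_length_eq)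
  also have "\<dots> = (\<Sum>l\<in>?N. m ^ l)" using card_lists_length_eq[of "{..<m}"] by simp
  also have "\<dots> = (\<Sum>j\<in>J. m ^ d j)" unfolding assms(2)[symmetric] by (rule sum.reindex_cong[OF assms(1)]) auto
  finally show ?thesis .
qed

end

section \<open>The homotopy type\<close>

text \<open>
  The two families of heights with a wedge of spheres differ only in the depth \<open>e\<close> of the topmost roots: if
  \<open>e = 1\<close>, the root of the tree is a separator.
\<close>

lemma depths_of_level_t:
  fixes t h :: nat
  assumes "h = n * (t + 2) + t + e" "e \<le> 1"
  shows "(\<lambda>j. j * (t + 2) + e) ` {0..n} = {l. l \<le> h \<and> (h - l) mod (t + 2) = t}"
proof (intro equalityI subsetI)
  fix l assume "l \<in> (\<lambda>j. j * (t + 2) + e) ` {0..n}"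
  then obtain j where j: "j \<le> n" "l = j * (t + 2) + e" by auto
  then obtain i where "n = j + i" using le_Suc_ex by blast
  then have "h = l + (t + i * (t + 2))" using assms(1) j(2) by (simp add: algebra_simps)
  moreover have "(t + i * (t + 2)) mod (t + 2) = t" unfolding mod_mult_self1 by simp
  ultimately show "l \<in> {l. l \<le> h \<and> (h - l) mod (t + 2) = t}"
    by (simp only: mem_Collect_eq add_diff_cancel_left') simp
next
  fix l assume "l \<in> {l. l \<le> h \<and> (h - l) mod (t + 2) = t}"
  then have l: "l \<le> h" "(h - l) mod (t + 2) = t" by auto
  define i where "i = (h - l) div (t + 2)"
  have "h - l = i * (t + 2) + t" using div_mult_mod_eq[of "h - l" "t + 2"] l(2) by (simp add: i_def)
  then have eq: "l + i * (t + 2) = n * (t + 2) + e" using assms(1) l(1) by linarith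
  have "i \<le> n"
  proof (rule ccontr)
    assume "\<not> i \<le> n"
    then have "Suc n * (t + 2) \<le> i * (t + 2)" by (intro mult_le_mono1) simp
    then have "n * (t + 2) + (t + 2) \<le> n * (t + 2) + e" using eq by simp
    then show False using assms(2) by simp
  qed
  then obtain d where d: "n = i + d" using le_Suc_ex by blast
  then have "l = d * (t + 2) + e" using eq by (simp add: algebra_simps)
  moreover have "d \<in> {0..n}" using d by simp
  ultimately show "l \<in> (\<lambda>j. j * (t + 2) + e) ` {0..n}" by (rule image_eqI)
qed

theorem theorem5p6:
  fixes m h t r s :: nat
  assumes "m \<ge> 3" and "t \<ge> 1"
    and "s \<in> {0..m ^ t - 1}"
    and "r = (\<Sum>i = 0..t - 1. m ^ i) + s"
  defines "X \<equiv> geometric_realization (independence_complex r (with_proj (perfect_tree m h)))"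
  shows
    "(\<forall>k\<ge>1. h = (k - 1) * (t + 2) + t + 1 \<longrightarrow>
        X homotopy_equivalent_space
          wedge_of_spheres
            (((m ^ t - 1) choose s) ^ (m * (\<Sum>j = 0..k - 1. m ^ (j * (t + 2)))))
            (m * r * (\<Sum>j = 0..k - 1. m ^ (j * (t + 2))) - 1)) \<and>
     (\<forall>k\<ge>0. h = k * (t + 2) + t \<longrightarrow>
        X homotopy_equivalent_space
          wedge_of_spheres
            (((m ^ t - 1) choose s) ^ (\<Sum>j = 0..k. m ^ (j * (t + 2))))
            (r * (\<Sum>j = 0..k. m ^ (j * (t + 2))) - 1)) \<and>
     ((\<nexists>k. k \<ge> 1 \<and> h = (k - 1) * (t + 2) + t + 1) \<and> (\<nexists>k. k \<ge> 0 \<and> h = k * (t + 2) + t) \<longrightarrow>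
        X homotopy_equivalent_space discrete_topology {()})"
proof -
  have "{0..t - 1} = {..<t}" using assms(2) by auto
  moreover have "s < m ^ t" using assms(1,3) by (simp add: Suc_leI le_diff_conv2 less_eq_Suc_le)
  ultimately interpret perfect_tree_levels m h t r s
    using assms(1,2,4) by unfold_locales simp_all
  have wedge: "X homotopy_equivalent_space wedge_of_spheres
      (((m ^ t - 1) choose s) ^ (\<Sum>j = 0..n. m ^ (j * (t + 2) + e))) (r * (\<Sum>j = 0..n. m ^ (j * (t + 2) + e)) - 1)"
    if h: "h = n * (t + 2) + t + e" "e \<le> 1" for n e
  proof -
    have inj: "inj_on (\<lambda>j. j * (t + 2) + e) {0..n}"
    proof (rule inj_onI)
      fix i j assume "i * (t + 2) + e = j * (t + 2) + e"
      then have "i * (t + 2) = j * (t + 2)" by (rule add_right_imp_eq)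
      then show "i = j" by (simp only: mult_cancel2) simp
    qed
    have "h = t + e + n * (t + 2)" using h(1) by simp
    then have "h mod (t + 2) = (t + e) mod (t + 2)" by (simp only: mod_mult_self1)
    then have "h mod (t + 2) = t + e" using h(2) by simp
    then have top: "t \<le> h mod (t + 2)" by simp
    show ?thesis
      using independence_complex_wedge[OF top]
      unfolding X_def card_Roots[OF inj depths_of_level_t[OF h]] .
  qed
  have "X homotopy_equivalent_space wedge_of_spheres
      (((m ^ t - 1) choose s) ^ (m * (\<Sum>j = 0..k - 1. m ^ (j * (t + 2)))))
      (m * r * (\<Sum>j = 0..k - 1. m ^ (j * (t + 2))) - 1)"
    if "h = (k - 1) * (t + 2) + t + 1" for k
    using wedge[OF that order_refl] by (simp add: sum_distrib_left mult_ac)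
  moreover have "X homotopy_equivalent_space wedge_of_spheres
      (((m ^ t - 1) choose s) ^ (\<Sum>j = 0..k. m ^ (j * (t + 2)))) (r * (\<Sum>j = 0..k. m ^ (j * (t + 2))) - 1)"
    if "h = k * (t + 2) + t" for k
    by (rule wedge[of k 0, unfolded add_0_right, OF that le0])
  moreover have "X homotopy_equivalent_space discrete_topology {()}"
    if no: "\<nexists>k. k \<ge> 1 \<and> h = (k - 1) * (t + 2) + t + 1" "\<nexists>k. k \<ge> 0 \<and> h = k * (t + 2) + t"
  proof -
    define n where "n = h div (t + 2)"
    have h: "h = n * (t + 2) + h mod (t + 2)"
      unfolding n_def by (rule div_mult_mod_eq[symmetric])
    have "h mod (t + 2) \<noteq> t"
    proof
      assume eq: "h mod (t + 2) = t"
      have "h = n * (t + 2) + t" using h unfolding eq .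
      then show False using no(2) le0 by blast
    qed
    moreover have "h mod (t + 2) \<noteq> t + 1"
    proof
      assume eq: "h mod (t + 2) = t + 1"
      have "h = (Suc n - 1) * (t + 2) + t + 1" using h unfolding eq by simp
      moreover have "1 \<le> Suc n" by simp
      ultimately show False using no(1) by blast
    qed
    moreover have "h mod (t + 2) < t + 2" by simp
    ultimately have "h mod (t + 2) < t" by linarith
    then show ?thesis unfolding X_def by (rule independence_complex_point)
  qed
  ultimately show ?thesis by blast
qed

end
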